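(* Let $F$ be a field, $G$ a countable group, $\omega$ a non-principal ultrafilter on $\mathbb{N}$ and $n_k\to\infty$. If $\Theta:G\to\prod_{k\to\omega}GL_{n_k}(F)/d_\omega$ is an injective group morphism, then there exist a sequence $m_k\to\infty$ and an injective algebra morphism $\Psi:F(G)\to\prod_{k\to\omega}M_{m_k}(F)/\operatorname{Ker}\rho_\omega$.
   Context: $F(G)$ denotes the group algebra of $G$ over $F$. For $a\in M_n(F)$, $\rho(a)=\operatorname{rk}(a)/n$; $\prod_{k\to\omega}M_{n_k}(F)/\operatorname{Ker}\rho_\omega$ is the quotient of $\prod_kM_{n_k}(F)$ by the ideal of sequences with $\lim_{k\to\omega}\rho(a_k)=0$. $\prod_{k\to\omega}GL_{n_k}(F)/d_\omega$ is the quotient of $\prod_kGL_{n_k}(F)$ by $\{(a_k)_k:\lim_{k\to\omega}\rho(a_k-\mathrm{Id})=0\}$. *)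

theory Defs
  imports "Jordan_Normal_Form.DL_Rank" "HOL-Algebra.QuotRing" "HOL-Library.Countable_Set"
begin

definition rk_ratio :: "nat \<Rightarrow> 'f::field mat \<Rightarrow> real" where
  "rk_ratio n a = real (vec_space.rank n a) / real n"

definition ultrafilter_nat :: "nat filter \<Rightarrow> bool" where
  "ultrafilter_nat U \<longleftrightarrow> U \<noteq> bot \<and> (\<forall>P. eventually P U \<or> eventually (\<lambda>x. \<not> P x) U)"

definition nonprincipal :: "nat filter \<Rightarrow> bool" where
  "nonprincipal U \<longleftrightarrow> (\<forall>i. eventually (\<lambda>k. k \<noteq> i) U)"

definition GL_prod :: "(nat \<Rightarrow> nat) \<Rightarrow> (nat \<Rightarrow> 'f::field mat) monoid" where
  "GL_prod n = \<lparr> carrier = {a. \<forall>k. a k \<in> carrier_mat (n k) (n k) \<and> invertible_mat (a k)},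
                 mult = (\<lambda>a b k. a k * b k),
                 one = (\<lambda>k. 1\<^sub>m (n k)) \<rparr>"

definition GL_null :: "nat filter \<Rightarrow> (nat \<Rightarrow> nat) \<Rightarrow> (nat \<Rightarrow> 'f::field mat) set" where
  "GL_null U n = {a \<in> carrier (GL_prod n).
      ((\<lambda>k. rk_ratio (n k) (a k - 1\<^sub>m (n k))) \<longlongrightarrow> 0) U}"

definition GL_ultra :: "nat filter \<Rightarrow> (nat \<Rightarrow> nat) \<Rightarrow> (nat \<Rightarrow> 'f::field mat) set monoid" where
  "GL_ultra U n = GL_prod n Mod GL_null U n"

definition Mat_prod :: "(nat \<Rightarrow> nat) \<Rightarrow> (nat \<Rightarrow> 'f::field mat) ring" where
  "Mat_prod m = \<lparr> carrier = {a. \<forall>k. a k \<in> carrier_mat (m k) (m k)},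
                  mult = (\<lambda>a b k. a k * b k),
                  one = (\<lambda>k. 1\<^sub>m (m k)),
                  zero = (\<lambda>k. 0\<^sub>m (m k) (m k)),
                  add = (\<lambda>a b k. a k + b k) \<rparr>"

definition Mat_ker :: "nat filter \<Rightarrow> (nat \<Rightarrow> nat) \<Rightarrow> (nat \<Rightarrow> 'f::field mat) set" where
  "Mat_ker U m = {a \<in> carrier (Mat_prod m). ((\<lambda>k. rk_ratio (m k) (a k)) \<longlongrightarrow> 0) U}"

definition Mat_ultra :: "nat filter \<Rightarrow> (nat \<Rightarrow> nat) \<Rightarrow> (nat \<Rightarrow> 'f::field mat) set ring" where
  "Mat_ultra U m = Mat_prod m Quot Mat_ker U m"

definition group_algebra :: "'g monoid \<Rightarrow> ('g \<Rightarrow> 'f::field) ring" where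
  "group_algebra G = \<lparr> carrier = {f. (\<forall>x. x \<notin> carrier G \<longrightarrow> f x = 0) \<and> finite {x. f x \<noteq> 0}},
      mult = (\<lambda>f g x. if x \<in> carrier G
                       then (\<Sum>y\<in>{y. f y \<noteq> 0}. f y * g (inv\<^bsub>G\<^esub> y \<otimes>\<^bsub>G\<^esub> x)) else 0),
      one = (\<lambda>x. if x = \<one>\<^bsub>G\<^esub> then 1 else 0),
      zero = (\<lambda>x. 0),
      add = (\<lambda>f g x. f x + g x) \<rparr>"

text \<open>F-algebra morphisms F(G) -> prod_{k->omega} M_{m_k}(F)/Ker rho_omega:
  unital ring homomorphisms that are F-linear (scalar multiplication on the quotient
  acts on representatives).\<close>
definition alg_hom_ultra ::
  "'g monoid \<Rightarrow> nat filter \<Rightarrow> (nat \<Rightarrow> nat) \<Rightarrow> (('g \<Rightarrow> 'f::field) \<Rightarrow> (nat \<Rightarrow> 'f mat) set) \<Rightarrow> bool" where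
  "alg_hom_ultra G U m \<Psi> \<longleftrightarrow>
     \<Psi> \<in> Ring.ring_hom (group_algebra G) (Mat_ultra U m) \<and>
     (\<forall>c. \<forall>f\<in>carrier (group_algebra G). \<forall>a\<in>\<Psi> f. (\<lambda>k. c \<cdot>\<^sub>m a k) \<in> \<Psi> (\<lambda>x. c * f x))"

end

(* For matrices u_i that are pairwise at rank distance at least e, put
   T_t(u) = (1 (+) u) (x) ... (x) (1 (+) u) with t factors, the identity block of the s-th factor
   (s = 0, 1, ...) being 2^(s+2) - 1 times as large as u. The map T_t is multiplicative, and
   since the weights 2^-(s+2) of u have sum at most 1, it does not increase the rank distance
   whatever t is. Hence G acts approximately by T_k(Theta(g)_k) at index k, and the linear
   extension of this action is an algebra morphism into the ultraproduct.

   For injectivity, multiplying 1 (+) u from both sides by suitable matrices that depend only on v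
   yields 0 (+) (u - v). Doing this in the first r - 1 factors with v running through u_2, ..., u_r,
   and keeping just the identity block in all other factors, turns c_1 T_t(u_1) + ... + c_r T_t(u_r)
   into c_1 times a tensor product with factors 0 (+) (u_1 - u_j) and 1 (+) 0: all other summands
   vanish. Its normalized rank is the product of those of the factors, which is bounded below by a
   positive number depending only on r and e, because the product of the 1 - 2^-(s+2) converges. *)
theory Submission
  imports Defs
begin

section \<open>Rank of a matrix over a field and its certificates by matrix identities\<close>

section \<open>Rank factorizations\<close>

text \<open>The columns of \<open>A * B\<close> are images under \<open>A\<close>, so its column
  space lies in that of \<open>A\<close> and the dimensions compare.\<close>

lemma rank_mult_left_le:
  fixes A :: "'f::field mat"
  assumes A: "A \<in> carrier_mat n m" and B: "B \<in> carrier_mat m l"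
  shows "vec_space.rank n (A * B) \<le> vec_space.rank n A"
proof -
  interpret vec_space "TYPE('f)" n .
  have AB: "A * B \<in> carrier_mat n l" using A B by simp
  have sub: "set (cols (A * B)) \<subseteq> span (set (cols A))"
  proof
    fix x assume "x \<in> set (cols (A * B))"
    then obtain j where j: "j < l" "x = col (A * B) j"
      using B by (auto simp: cols_def)
    then have "x = A *\<^sub>v col B j" using col_mult2[OF A B j(1)] by simp
    moreover have "A *\<^sub>v col B j \<in> col_space A"
      unfolding col_space_eq[OF A] using A B j by auto
    ultimately show "x \<in> span (set (cols A))" by (simp add: col_space_def)
  qed
  have cA: "set (cols A) \<subseteq> carrier_vec n" using A cols_dim by blast
  have cAB: "set (cols (A * B)) \<subseteq> carrier_vec n" using AB cols_dim by blast
  have sA: "subspace class_ring (span (set (cols A))) V"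
    and sAB: "subspace class_ring (span (set (cols (A * B)))) V"
    using cA cAB span_is_subspace by auto
  have "span (set (cols (A * B))) \<subseteq> span (set (cols A))"
    using sub by (simp add: span_is_subset sA cA span_is_submodule)
  then have "subspace class_ring (span (set (cols (A * B)))) (span_vs (set (cols A)))"
    by (rule nested_subspaces[OF sA sAB])
  from vectorspace.subspace_dim[OF subspace_is_vs[OF sA] this]
  show ?thesis unfolding rank_def
    using fin_dim_span_cols[OF A] fin_dim_span_cols[OF AB] by simp
qed

lemma rank_mult_le_inner:
  fixes A :: "'f::field mat"
  assumes A: "A \<in> carrier_mat n m" and B: "B \<in> carrier_mat m l"
  shows "vec_space.rank n (A * B) \<le> m"
  using rank_mult_left_le[OF A B] vec_space.rank_le_nc[OF A] by linarith

text \<open>A left inverse makes \<open>B\<close> injective on vectors, which forces the columns to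
  be distinct and linearly independent.\<close>

lemma rank_left_invertible:
  fixes B :: "'f::field mat"
  assumes P: "P \<in> carrier_mat r n" and B: "B \<in> carrier_mat n r" and PB: "P * B = 1\<^sub>m r"
  shows "vec_space.rank n B = r"
proof -
  interpret vec_space "TYPE('f)" n .
  have inj: "v = w" if v: "v \<in> carrier_vec r" and w: "w \<in> carrier_vec r" 
    and eq: "B *\<^sub>v v = B *\<^sub>v w" for v w
  proof -
    have "(P * B) *\<^sub>v v = (P * B) *\<^sub>v w"
      using assoc_mult_mat_vec[OF P B v] assoc_mult_mat_vec[OF P B w] eq by simp
    with PB v w show ?thesis by simp
  qed
  \<comment> \<open>Distinctness is treated separately because linear independence speaks of the set
    of columns, in which a repeated column would not show.\<close>
  have "distinct (cols B)"
  proof (subst distinct_conv_nth, intro allI impI)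
    fix i j assume ij: "i < length (cols B)" "j < length (cols B)" "i \<noteq> j"
    then have lt: "i < r" "j < r" using B by auto
    have *: "B *\<^sub>v unit_vec r k = col B k" if "k < r" for k
      using B that by (intro eq_vecI) auto
    show "cols B ! i \<noteq> cols B ! j"
    proof
      assume "cols B ! i = cols B ! j"
      then have "col B i = col B j" using lt B by simp
      then have "unit_vec r i = (unit_vec r j :: 'f vec)"
        using inj[of "unit_vec r i" "unit_vec r j"] *[OF lt(1)] *[OF lt(2)] by simp
      then have "(unit_vec r i :: 'f vec) $ i = unit_vec r j $ i" by simp
      then show False using lt ij(3) by simp
    qed
  qed
  moreover have "lin_indpt (set (cols B))"
  proof
    assume "lin_dep (set (cols B))"
    from lin_depE[OF B this \<open>distinct (cols B)\<close>] obtain v where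
      v: "v \<in> carrier_vec r" "v \<noteq> 0\<^sub>v r" "B *\<^sub>v v = 0\<^sub>v n" by blast
    have "B *\<^sub>v 0\<^sub>v r = 0\<^sub>v n" using B by (intro eq_vecI) auto
    with v inj[of v "0\<^sub>v r"] show False by simp
  qed
  ultimately show ?thesis using lin_indpt_full_rank[OF B] by blast
qed

text \<open>\<open>A * Q\<close> has the left inverse \<open>P\<close> and hence rank
  \<open>r\<close>; right multiplication by \<open>Q\<close> cannot have raised the rank.\<close>

lemma rank_ge_if_mult_eq_one:
  fixes A :: "'f::field mat"
  assumes A: "A \<in> carrier_mat n m" and P: "P \<in> carrier_mat r n" and Q: "Q \<in> carrier_mat m r"
    and eq: "P * A * Q = 1\<^sub>m r"
  shows "r \<le> vec_space.rank n A"
proof -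
  have "P * (A * Q) = 1\<^sub>m r" using A P Q eq by (simp add: assoc_mult_mat)
  then have "vec_space.rank n (A * Q) = r"
    using rank_left_invertible[OF P] A Q by simp
  with rank_mult_left_le[OF A Q] show ?thesis by simp
qed

text \<open>The rank is expressed by matrix identities alone: \<open>A = X * Y\<close> certifies it
  from above and \<open>P * A * Q = 1\<close> from below. Such certificates can be combined
  blockwise and tensored, which is how the ranks of block sums and Kronecker products are found.
  They come from Gauss-Jordan elimination.\<close>

lemma rank_factorization:
  fixes A :: "'f::field mat"
  assumes A: "A \<in> carrier_mat n m"
  obtains X Y P Q where
    "X \<in> carrier_mat n (vec_space.rank n A)" "Y \<in> carrier_mat (vec_space.rank n A) m"
    "P \<in> carrier_mat (vec_space.rank n A) n" "Q \<in> carrier_mat m (vec_space.rank n A)"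
    "A = X * Y" "P * A * Q = 1\<^sub>m (vec_space.rank n A)"
proof -
  obtain C P0 Q0 where C: "C \<in> carrier_mat n m" and ref: "row_echelon_form C"
    and CP: "C = P0 * A" and P0: "P0 \<in> carrier_mat n n" and Q0: "Q0 \<in> carrier_mat n n"
    and inv: "Q0 * P0 = 1\<^sub>m n"
    using gauss_jordan_single(2-4)[OF A refl] by blast
  obtain f where "pivot_fun C f (dim_col C)" using ref by (auto simp: row_echelon_form_def)
  then have piv: "pivot_fun C f m" using C by simp
  have dC: "dim_row C = n" using C by simp
  note pD = pivot_funD[OF dC piv]
  \<comment> \<open>The pivot function takes the value \<open>m\<close>, the number of columns, on a
    zero row. So \<open>r\<close> counts the nonzero rows; the alternative \<open>i = n\<close>
    covers the case that no row is zero.\<close>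
  define r where "r = (LEAST i. i = n \<or> f i = m)"
  have r: "r = n \<or> f r = m" unfolding r_def by (rule LeastI[of _ n]) simp
  have rn: "r \<le> n" unfolding r_def by (rule Least_le) simp
  have below: "f i < m" if "i < r" for i
  proof -
    have "\<not> (i = n \<or> f i = m)" using not_less_Least[OF that[unfolded r_def]] .
    with pD(1)[of i] that rn show ?thesis by (simp add: order_less_le)
  qed
  have above: "f i = m" if i: "r \<le> i" "i < n" for i
  proof (cases "i = r")
    case True with r i show ?thesis by auto
  next
    case False
    with i have "r < i" by simp
    with pivot_bound[OF dC piv, of r "i - r"] i r have "f i = m \<or> f i \<ge> (i - r) + m" by auto
    with pD(1)[OF i(2)] \<open>r < i\<close> show ?thesis by auto
  qed
  have zero_row: "C $$ (i, j) = 0" if "r \<le> i" "i < n" "j < m" for i j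
    using pD(2)[of i j] above[of i] that by simp
  \<comment> \<open>\<open>J\<close> keeps the first \<open>r\<close> rows and \<open>Q\<close>
    selects the pivot columns, so \<open>J * C * Q\<close> is the identity; \<open>J\<^sup>T\<close>
    puts the rows back, which loses nothing since the rows of \<open>C\<close> from \<open>r\<close>
    on vanish.\<close>
  define J where "J = mat r n (\<lambda>(i,j). if j = i then 1 else (0::'f))"
  define Q where "Q = mat m r (\<lambda>(i,j). if i = f j then 1 else (0::'f))"
  have J: "J \<in> carrier_mat r n" and Q: "Q \<in> carrier_mat m r"
    by (auto simp: J_def Q_def)
  have JC: "(J * C) $$ (i, j) = C $$ (i, j)" if "i < r" "j < m" for i j
    using that rn C by (simp add: J_def scalar_prod_def if_distrib[where f="\<lambda>x. x * _"] 
        sum.delta cong: if_cong)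
  have "J * C * Q = 1\<^sub>m r"
  proof (rule eq_matI)
    fix i j assume "i < dim_row (1\<^sub>m r :: 'f mat)" "j < dim_col (1\<^sub>m r :: 'f mat)"
    then have ij: "i < r" "j < r" by auto
    have "(J * C * Q) $$ (i, j) = (\<Sum>k<m. (J * C) $$ (i, k) * (if k = f j then 1 else 0))"
      using ij J C Q by (simp add: scalar_prod_def Q_def lessThan_atLeast0)
    also have "\<dots> = (J * C) $$ (i, f j)"
      using below[OF ij(2)] by (simp add: if_distrib sum.delta cong: if_cong)
    also have "\<dots> = C $$ (i, f j)" using JC ij below by simp
    also have "\<dots> = (1\<^sub>m r) $$ (i, j)"
      using pD(4)[of j] pD(5)[of j i] below[OF ij(2)] ij rn by (cases "i = j") auto
    finally show "(J * C * Q) $$ (i, j) = (1\<^sub>m r) $$ (i, j)" .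
  qed (use J C Q in auto)
  then have PAQ: "(J * P0) * A * Q = 1\<^sub>m r"
    using J P0 A Q by (simp add: CP assoc_mult_mat)
  have "J\<^sup>T * (J * C) = C"
  proof (rule eq_matI)
    fix i j assume "i < dim_row C" "j < dim_col C"
    then have ij: "i < n" "j < m" using C by auto
    have "(J\<^sup>T * (J * C)) $$ (i, j) = (\<Sum>k<r. (if i = k then 1 else 0) * (J * C) $$ (k, j))"
      using ij J C rn by (simp add: scalar_prod_def J_def lessThan_atLeast0)
    also have "\<dots> = (\<Sum>k<r. if i = k then C $$ (k, j) else 0)"
      using JC ij by (intro sum.cong) auto
    also have "\<dots> = C $$ (i, j)" using zero_row ij by auto
    finally show "(J\<^sup>T * (J * C)) $$ (i, j) = C $$ (i, j)" .
  qed (use J C in auto)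
  then have "Q0 * (J\<^sup>T * (J * C)) = (Q0 * P0) * A" using CP Q0 P0 A by (simp add: assoc_mult_mat)
  also have "\<dots> = A" using inv A by simp
  finally have fac: "A = (Q0 * J\<^sup>T) * (J * C)"
    using Q0 J C by (simp add: assoc_mult_mat[of _ n n _ r _ m])
  have X: "Q0 * J\<^sup>T \<in> carrier_mat n r" and Y: "J * C \<in> carrier_mat r m" and P: "J * P0 \<in> carrier_mat r n"
    using Q0 J C P0 by auto
  have "vec_space.rank n A = r"
    using rank_mult_le_inner[OF X Y] fac rank_ge_if_mult_eq_one[OF A P Q PAQ] by simp
  with that X Y P Q fac PAQ show thesis by metis
qed

text \<open>If \<open>B\<close> factors through the dimension of its rank, so does
  \<open>A * B\<close>.\<close>

lemma rank_mult_right_le: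
  fixes A :: "'f::field mat"
  assumes A: "A \<in> carrier_mat n m" and B: "B \<in> carrier_mat m l"
  shows "vec_space.rank n (A * B) \<le> vec_space.rank m B"
proof -
  obtain X Y where XY: "X \<in> carrier_mat m (vec_space.rank m B)" 
    "Y \<in> carrier_mat (vec_space.rank m B) l" "B = X * Y"
    by (rule rank_factorization[OF B])
  then have "A * B = (A * X) * Y" using A by (metis assoc_mult_mat)
  then show ?thesis using rank_mult_le_inner[of "A * X" n _ Y l] XY(1,2) A by simp
qed

text \<open>The converse use of a certificate: the factorization bounds the rank by \<open>r\<close>
  from above, the identity from below.\<close>

lemma rank_eqI:
  fixes A :: "'f::field mat"
  assumes "X \<in> carrier_mat n r" "Y \<in> carrier_mat r m" "P \<in> carrier_mat r n" "Q \<in> carrier_mat m r"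
    and "A = X * Y" "P * A * Q = 1\<^sub>m r"
  shows "vec_space.rank n A = r"
  using rank_mult_le_inner[of X n r Y m] rank_ge_if_mult_eq_one[of A n m P r Q] assms by fastforce

text \<open>Certificates of the two blocks are put together block by block.\<close>

lemma rank_block_diag:
  fixes A B :: "'f::field mat"
  assumes A: "A \<in> carrier_mat n n" and B: "B \<in> carrier_mat m m"
  shows "vec_space.rank (n + m) (four_block_mat A (0\<^sub>m n m) (0\<^sub>m m n) B)
    = vec_space.rank n A + vec_space.rank m B"
proof -
  define a where "a = vec_space.rank n A"
  define b where "b = vec_space.rank m B"
  obtain X Y P Q where 1: "X \<in> carrier_mat n a" "Y \<in> carrier_mat a n"
    "P \<in> carrier_mat a n" "Q \<in> carrier_mat n a" "A = X * Y" "P * A * Q = 1\<^sub>m a"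
    unfolding a_def by (rule rank_factorization[OF A])
  obtain X' Y' P' Q' where 2: "X' \<in> carrier_mat m b" "Y' \<in> carrier_mat b m"
    "P' \<in> carrier_mat b m" "Q' \<in> carrier_mat m b" "B = X' * Y'" "P' * B * Q' = 1\<^sub>m b"
    unfolding b_def by (rule rank_factorization[OF B])
  let ?d = "\<lambda>i j k l x y. four_block_mat x (0\<^sub>m i l) (0\<^sub>m k j) (y :: 'f mat)"
  have mul: "?d i j k l x y * ?d j p l q z w = ?d i p k q (x * z) (y * w)"
    if "x \<in> carrier_mat i j" "y \<in> carrier_mat k l" "z \<in> carrier_mat j p" "w \<in> carrier_mat l q" 
    for i j k l p q x y z w
    using that by (subst mult_four_block_mat[of _ i j _ l _ k _ _ p _ q]) auto
  have "?d n n m m A B = ?d n a m b X X' * ?d a n b m Y Y'"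
    using 1 2 mul by metis
  moreover have "?d a n b m P P' * ?d n n m m A B * ?d n a m b Q Q' = 1\<^sub>m (a + b)"
    using 1(3,4,6) 2(3,4,6) A B by (simp add: mul)
  ultimately show ?thesis unfolding a_def[symmetric] b_def[symmetric]
    by (intro rank_eqI[where X = "?d n a m b X X'" and Y = "?d a n b m Y Y'"
        and P = "?d a n b m P P'" and Q = "?d n a m b Q Q'" and m = "n + m"]) 
      (use 1 2 in auto)
qed

section \<open>Kronecker products: multiplicativity and rank\<close>

section \<open>Kronecker products\<close>

definition kron :: "'a::semiring_0 mat \<Rightarrow> 'a mat \<Rightarrow> 'a mat" where
  "kron A B = mat (dim_row A * dim_row B) (dim_col A * dim_col B)
     (\<lambda>(i, j). A $$ (i div dim_row B, j div dim_col B) * B $$ (i mod dim_row B, j mod dim_col B))"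

lemma kron_carrier [simp]:
  "A \<in> carrier_mat n m \<Longrightarrow> B \<in> carrier_mat k l \<Longrightarrow> kron A B \<in> carrier_mat (n * k) (m * l)"
  by (auto simp: kron_def)

lemma kron_index:
  assumes "A \<in> carrier_mat n m" "B \<in> carrier_mat k l" "i < n * k" "j < m * l"
  shows "kron A B $$ (i, j) = A $$ (i div k, j div l) * B $$ (i mod k, j mod l)"
  using assms by (auto simp: kron_def)

lemma div_mod_less_mult:
  fixes i :: nat
  assumes "i < n * k"
  shows "i div k < n" "i mod k < k"
proof -
  have "0 < k" using assms by (cases k) auto
  then show "i mod k < k" by simp
  show "i div k < n" using assms by (simp add: less_mult_imp_div_less)
qed

text \<open>Division with remainder by \<open>k\<close> is a bijection from the numbers below
  \<open>m * k\<close> to pairs; this splits the contracted index in a product of Kronecker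
  products.\<close>

lemma sum_lessThan_mult:
  fixes f :: "nat \<Rightarrow> nat \<Rightarrow> 'a::comm_monoid_add"
  shows "(\<Sum>l<m * k. f (l div k) (l mod k)) = (\<Sum>a<m. \<Sum>b<k. f a b)"
proof (cases "k = 0")
  case False
  have "(\<Sum>a<m. \<Sum>b<k. f a b) = (\<Sum>(a, b)\<in>{..<m} \<times> {..<k}. f a b)"
    by (simp add: sum.cartesian_product)
  also have "\<dots> = (\<Sum>l<m * k. f (l div k) (l mod k))"
  proof (rule sum.reindex_bij_witness[where i = "\<lambda>l. (l div k, l mod k)" and j = "\<lambda>(a, b). a * k + b"])
    fix p assume p: "p \<in> {..<m} \<times> {..<k}"
    obtain a b where ab: "p = (a, b)" by force
    with p have "a < m" "b < k" by auto
    then have "a * k + b < (a + 1) * k" "(a + 1) * k \<le> m * k" 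
      by (simp, intro mult_right_mono) auto
    then show "(case p of (a, b) \<Rightarrow> a * k + b) \<in> {..<m * k}" using ab by simp
  qed (use False div_mod_less_mult in auto)
  finally show ?thesis by simp
qed simp

text \<open>The mixed-product rule: once the contracted index is split into a pair, the double sum
  is a product of two sums.\<close>

lemma kron_mult:
  fixes A B C D :: "'a::comm_semiring_0 mat"
  assumes A: "A \<in> carrier_mat n m" and B: "B \<in> carrier_mat k l"
    and C: "C \<in> carrier_mat m p" and D: "D \<in> carrier_mat l q"
  shows "kron A B * kron C D = kron (A * C) (B * D)"
proof (rule eq_matI)
  fix i j assume "i < dim_row (kron (A * C) (B * D))" "j < dim_col (kron (A * C) (B * D))"
  then have ij: "i < n * k" "j < p * q" using A B C D by (auto simp: kron_def)
  note dm = div_mod_less_mult[OF ij(1)] div_mod_less_mult[OF ij(2)]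
  have "(kron A B * kron C D) $$ (i, j) = (\<Sum>x<m * l. kron A B $$ (i, x) * kron C D $$ (x, j))"
    using ij kron_carrier[OF A B] kron_carrier[OF C D] by (simp add: scalar_prod_def lessThan_atLeast0)
  also have "\<dots> = (\<Sum>x<m * l. (A $$ (i div k, x div l) * B $$ (i mod k, x mod l)) *
      (C $$ (x div l, j div q) * D $$ (x mod l, j mod q)))"
    using ij by (intro sum.cong) (simp_all add: kron_index[OF A B] kron_index[OF C D])
  also have "\<dots> = (\<Sum>a<m. \<Sum>b<l. (A $$ (i div k, a) * B $$ (i mod k, b)) * (C $$ (a, j div q) * D $$ (b, j mod q)))"
    by (rule sum_lessThan_mult)
  also have "\<dots> = (\<Sum>a<m. A $$ (i div k, a) * C $$ (a, j div q)) * (\<Sum>b<l. B $$ (i mod k, b) * D $$ (b, j mod q))"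
    by (simp add: sum_product ac_simps)
  also have "\<dots> = (A * C) $$ (i div k, j div q) * (B * D) $$ (i mod k, j mod q)"
    using A B C D dm by (simp add: scalar_prod_def lessThan_atLeast0)
  also have "\<dots> = kron (A * C) (B * D) $$ (i, j)"
    by (rule kron_index[symmetric, of _ n p _ k q]) (use A B C D ij in auto)
  finally show "(kron A B * kron C D) $$ (i, j) = kron (A * C) (B * D) $$ (i, j)" .
qed (use A B C D in \<open>auto simp: kron_def\<close>)

lemma kron_one: "kron (1\<^sub>m n) (1\<^sub>m m) = (1\<^sub>m (n * m) :: 'a::semiring_1 mat)"
proof (rule eq_matI)
  fix i j assume "i < dim_row (1\<^sub>m (n * m) :: 'a mat)" "j < dim_col (1\<^sub>m (n * m) :: 'a mat)"
  then have ij: "i < n * m" "j < n * m" by auto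
  note dm = div_mod_less_mult[OF ij(1)] div_mod_less_mult[OF ij(2)]
  have "i = j \<longleftrightarrow> i div m = j div m \<and> i mod m = j mod m" by (metis div_mult_mod_eq)
  then show "kron (1\<^sub>m n) (1\<^sub>m m) $$ (i, j) = (1\<^sub>m (n * m) :: 'a mat) $$ (i, j)"
    using ij dm by (auto simp: kron_index[of _ n n _ m m])
qed (auto simp: kron_def)

lemma kron_minus_left:
  fixes A A' B :: "'a::ring mat"
  assumes "A \<in> carrier_mat n m" "A' \<in> carrier_mat n m" "B \<in> carrier_mat k l"
  shows "kron (A - A') B = kron A B - kron A' B"
  using assms by (intro eq_matI) (auto simp: kron_def left_diff_distrib div_mod_less_mult)

lemma kron_minus_right:
  fixes A B B' :: "'a::ring mat"
  assumes "A \<in> carrier_mat n m" "B \<in> carrier_mat k l" "B' \<in> carrier_mat k l"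
  shows "kron A (B - B') = kron A B - kron A B'"
  using assms by (intro eq_matI) (auto simp: kron_def right_diff_distrib div_mod_less_mult)

lemma kron_zero [simp]:
  fixes A :: "'a::semiring_0 mat"
  assumes "A \<in> carrier_mat n m"
  shows "kron A (0\<^sub>m k l) = 0\<^sub>m (n * k) (m * l)" "kron (0\<^sub>m k l) A = 0\<^sub>m (k * n) (l * m)"
  using assms by (auto intro!: eq_matI simp: kron_def div_mod_less_mult)

text \<open>By the mixed-product rule the Kronecker products of two certificates certify the product
  of the ranks.\<close>

lemma rank_kron:
  fixes A B :: "'f::field mat"
  assumes A: "A \<in> carrier_mat n n" and B: "B \<in> carrier_mat m m"
  shows "vec_space.rank (n * m) (kron A B) = vec_space.rank n A * vec_space.rank m B"
proof -
  define a where "a = vec_space.rank n A"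
  define b where "b = vec_space.rank m B"
  obtain X Y P Q where 1: "X \<in> carrier_mat n a" "Y \<in> carrier_mat a n"
    "P \<in> carrier_mat a n" "Q \<in> carrier_mat n a" "A = X * Y" "P * A * Q = 1\<^sub>m a"
    unfolding a_def by (rule rank_factorization[OF A])
  obtain X' Y' P' Q' where 2: "X' \<in> carrier_mat m b" "Y' \<in> carrier_mat b m"
    "P' \<in> carrier_mat b m" "Q' \<in> carrier_mat m b" "B = X' * Y'" "P' * B * Q' = 1\<^sub>m b"
    unfolding b_def by (rule rank_factorization[OF B])
  have "kron A B = kron X X' * kron Y Y'"
    using kron_mult[OF 1(1) 2(1) 1(2) 2(2)] 1(5) 2(5) by simp
  moreover have "kron P P' * kron A B * kron Q Q' = 1\<^sub>m (a * b)"
    using kron_mult[OF 1(3) 2(3) A B] kron_mult[OF mult_carrier_mat[OF 1(3) A] mult_carrier_mat[OF 2(3) B] 1(4) 2(4)]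
      1(6) 2(6) kron_one by metis
  ultimately show ?thesis unfolding a_def[symmetric] b_def[symmetric]
    by (intro rank_eqI[where X = "kron X X'" and Y = "kron Y Y'" and P = "kron P P'" 
          and Q = "kron Q Q'" and m = "n * m"]) (use 1(1-4) 2(1-4) in auto)
qed

section \<open>Normalized rank: behaviour under scalars, products, sums and Kronecker
  products\<close>

section \<open>Normalized rank\<close>

lemma rank_smult_le:
  fixes A :: "'f::field mat"
  assumes A: "A \<in> carrier_mat n n"
  shows "vec_space.rank n (c \<cdot>\<^sub>m A) \<le> vec_space.rank n A"
  using rank_mult_right_le[of "c \<cdot>\<^sub>m 1\<^sub>m n" n n A n] A by (simp add: mult_smult_assoc_mat[of _ n n])

lemma rk_ratio_nonneg: "0 \<le> rk_ratio n A"
  by (simp add: rk_ratio_def)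

lemma rk_ratio_le_1:
  fixes A :: "'f::field mat"
  assumes "A \<in> carrier_mat n n"
  shows "rk_ratio n A \<le> 1"
  \<comment> \<open>In dimension 0 the ratio is 0 because division by 0 yields 0.\<close>
  using vec_space.rank_le_nc[OF assms] by (cases "n = 0") (simp_all add: rk_ratio_def)

lemma rk_ratio_mult_le:
  fixes A B :: "'f::field mat"
  assumes "A \<in> carrier_mat n n" "B \<in> carrier_mat n n"
  shows "rk_ratio n (A * B) \<le> rk_ratio n A" "rk_ratio n (A * B) \<le> rk_ratio n B"
  using rank_mult_left_le[OF assms] rank_mult_right_le[OF assms] 
  by (auto simp: rk_ratio_def intro!: divide_right_mono)

lemma rk_ratio_smult_le:
  fixes A :: "'f::field mat"
  assumes "A \<in> carrier_mat n n"
  shows "rk_ratio n (c \<cdot>\<^sub>m A) \<le> rk_ratio n A"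
  using rank_smult_le[OF assms] by (auto simp: rk_ratio_def intro!: divide_right_mono)

lemma rk_ratio_smult:
  fixes A :: "'f::field mat"
  assumes A: "A \<in> carrier_mat n n" and c: "c \<noteq> 0"
  shows "rk_ratio n (c \<cdot>\<^sub>m A) = rk_ratio n A"
proof -
  have "inverse c \<cdot>\<^sub>m (c \<cdot>\<^sub>m A) = A" using c by (intro eq_matI) auto
  then show ?thesis
    using rk_ratio_smult_le[OF A, of c] rk_ratio_smult_le[of "c \<cdot>\<^sub>m A" n "inverse c"] A by simp
qed

lemma rk_ratio_add_le:
  fixes A B :: "'f::field mat"
  assumes "A \<in> carrier_mat n n" "B \<in> carrier_mat n n"
  shows "rk_ratio n (A + B) \<le> rk_ratio n A + rk_ratio n B"
  using vec_space.rank_subadditive[OF assms] 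
  by (simp add: rk_ratio_def add_divide_distrib[symmetric] divide_right_mono 
      flip: of_nat_add)

lemma rk_ratio_minus_commute:
  fixes A B :: "'f::field mat"
  assumes "A \<in> carrier_mat n n" "B \<in> carrier_mat n n"
  shows "rk_ratio n (A - B) = rk_ratio n (B - A)"
proof -
  have "A - B = (-1) \<cdot>\<^sub>m (B - A)" using assms by (intro eq_matI) auto
  then show ?thesis using rk_ratio_smult[of "B - A" n "-1"] assms by (simp add: minus_carrier_mat)
qed

lemma rk_ratio_triangle:
  fixes A B C :: "'f::field mat"
  assumes "A \<in> carrier_mat n n" "B \<in> carrier_mat n n" "C \<in> carrier_mat n n"
  shows "rk_ratio n (A - C) \<le> rk_ratio n (A - B) + rk_ratio n (B - C)"
proof -
  have "A - C = (A - B) + (B - C)" using assms by (intro eq_matI) auto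
  then show ?thesis using rk_ratio_add_le[of "A - B" n "B - C"] assms by (simp add: minus_carrier_mat)
qed

lemma rk_ratio_zero [simp]: "rk_ratio n (0\<^sub>m n m :: 'f::field mat) = 0"
  by (simp add: rk_ratio_def vec_space.rank_0I)

lemma rk_ratio_minus_self:
  fixes A :: "'f::field mat"
  assumes "A \<in> carrier_mat n n"
  shows "rk_ratio n (A - A) = 0"
proof -
  have "A - A = 0\<^sub>m n n" using assms by (intro eq_matI) auto
  then show ?thesis by simp
qed

lemma rk_ratio_one: "n > 0 \<Longrightarrow> rk_ratio n (1\<^sub>m n :: 'f::field mat) = 1"
  using rank_left_invertible[of "1\<^sub>m n" n n "1\<^sub>m n :: 'f mat"] by (simp add: rk_ratio_def)

lemma rk_ratio_kron:
  fixes A B :: "'f::field mat"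
  assumes "A \<in> carrier_mat n n" "B \<in> carrier_mat m m"
  shows "rk_ratio (n * m) (kron A B) = rk_ratio n A * rk_ratio m B"
  using rank_kron[OF assms] by (simp add: rk_ratio_def)

section \<open>The padded tensor powers T_t: contraction property and lower bounds\<close>

section \<open>Tensor powers of padded matrices\<close>

definition diag_sum :: "nat \<Rightarrow> nat \<Rightarrow> 'f::field mat \<Rightarrow> 'f mat \<Rightarrow> 'f mat" where
  "diag_sum N n A B = four_block_mat A (0\<^sub>m N n) (0\<^sub>m n N) B"

lemma diag_sum_carrier [simp]:
  "A \<in> carrier_mat N N \<Longrightarrow> B \<in> carrier_mat n n \<Longrightarrow> diag_sum N n A B \<in> carrier_mat (N + n) (N + n)"
  by (simp add: diag_sum_def)

lemma diag_sum_mult: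
  assumes "A \<in> carrier_mat N N" "B \<in> carrier_mat n n" "C \<in> carrier_mat N N" "D \<in> carrier_mat n n"
  shows "diag_sum N n A B * diag_sum N n C D = diag_sum N n (A * C) (B * D)"
  unfolding diag_sum_def using assms by (subst mult_four_block_mat[of _ N N _ n _ n _ _ N _ n]) auto

lemma rk_ratio_diag_sum:
  assumes "A \<in> carrier_mat N N" "B \<in> carrier_mat n n"
  shows "rk_ratio (N + n) (diag_sum N n A B) = 
    (N * rk_ratio N A + n * rk_ratio n B) / (N + n)"
proof -
  \<comment> \<open>This also holds for \<open>m = 0\<close>: the rank is then 0, like the quotient
    by 0.\<close>
  have *: "m * rk_ratio m X = vec_space.rank m X" if "X \<in> carrier_mat m m" for m and X :: "'a mat"
    using vec_space.rank_le_nc[OF that] by (cases "m = 0") (simp_all add: rk_ratio_def)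
  show ?thesis
    unfolding *[OF assms(1)] *[OF assms(2)] using rank_block_diag[OF assms]
    by (simp add: rk_ratio_def diag_sum_def)
qed

definition pad_dim :: "nat \<Rightarrow> nat \<Rightarrow> nat" where
  "pad_dim n s = (2 ^ (s + 2) - 1) * n"

lemma pad_dim_add: "pad_dim n s + n = 2 ^ (s + 2) * n"
  by (simp add: pad_dim_def algebra_simps)

text \<open>Makes room for the cancellation in \<open>diag_sum_compress\<close>, which uses a copy
  of the identity of size \<open>n\<close> inside the padding.\<close>

lemma le_pad_dim: "n \<le> pad_dim n s"
proof -
  have "(1::nat) \<le> 2 ^ s" by simp
  then have "1 \<le> 4 * 2 ^ s - (1::nat)" by linarith
  then have "1 \<le> 2 ^ (s + 2) - (1::nat)" by simp
  then have "1 * n \<le> pad_dim n s" unfolding pad_dim_def by (intro mult_right_mono) auto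
  then show ?thesis by simp
qed

primrec amp_dim :: "nat \<Rightarrow> nat \<Rightarrow> nat" where
  "amp_dim n 0 = 1"
| "amp_dim n (Suc s) = amp_dim n s * (pad_dim n s + n)"

text \<open>T_t(u) of the introductory comment, built from the left; the 1 by 1 identity is the
  empty tensor product.\<close>

primrec amp :: "nat \<Rightarrow> nat \<Rightarrow> 'f::field mat \<Rightarrow> 'f mat" where
  "amp n 0 u = 1\<^sub>m 1"
| "amp n (Suc s) u = kron (amp n s u) (diag_sum (pad_dim n s) n (1\<^sub>m (pad_dim n s)) u)"

lemma amp_carrier [simp]: 
  "u \<in> carrier_mat n n \<Longrightarrow> amp n t u \<in> carrier_mat (amp_dim n t) (amp_dim n t)"
  by (induction t) auto

lemma amp_mult:
  assumes "u \<in> carrier_mat n n" "v \<in> carrier_mat n n"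
  shows "amp n t u * amp n t v = amp n t (u * v)"
proof (induction t)
  case (Suc t)
  let ?D = "diag_sum (pad_dim n t) n (1\<^sub>m (pad_dim n t))"
  have "amp n (Suc t) u * amp n (Suc t) v = kron (amp n t u * amp n t v) (?D u * ?D v)"
    using assms by (simp add: kron_mult[of _ "amp_dim n t" "amp_dim n t" _ "pad_dim n t + n" "pad_dim n t + n"
          _ "amp_dim n t" _ "pad_dim n t + n"])
  then show ?case using assms by (simp add: Suc diag_sum_mult)
qed simp

lemma amp_one: "amp n t (1\<^sub>m n) = (1\<^sub>m (amp_dim n t) :: 'f::field mat)"
  by (induction t) (simp_all add: diag_sum_def kron_one)

text \<open>The block \<open>u\<close> fills the fraction 2^-(s+2) of the factor, and its normalized
  rank is scaled by that weight.\<close>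

lemma rk_ratio_diag_sum_pad:
  fixes u :: "'f::field mat"
  assumes u: "u \<in> carrier_mat n n"
  shows "rk_ratio (pad_dim n s + n) (diag_sum (pad_dim n s) n (0\<^sub>m (pad_dim n s) (pad_dim n s)) u) 
    = rk_ratio n u / 2 ^ (s + 2)"
proof -
  have "real (pad_dim n s + n) = 2 ^ (s + 2) * real n" by (simp only: pad_dim_add) simp
  then have "rk_ratio (pad_dim n s + n) (diag_sum (pad_dim n s) n (0\<^sub>m (pad_dim n s) (pad_dim n s)) u) 
    = (real n * rk_ratio n u) / (2 ^ (s + 2) * real n)"
    using u by (simp add: rk_ratio_diag_sum)
  then show ?thesis by (cases "n = 0") (simp_all add: rk_ratio_def)
qed

lemma diag_sum_pad_minus:
  fixes u :: "'f::field mat"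
  assumes "u \<in> carrier_mat n n" "v \<in> carrier_mat n n"
  shows "diag_sum N n (1\<^sub>m N) u - diag_sum N n (1\<^sub>m N) v = diag_sum N n (0\<^sub>m N N) (u - v)"
  using assms by (intro eq_matI) (auto simp: diag_sum_def minus_carrier_mat)

text \<open>Telescoping: if D is the factor added in passing from \<open>t\<close> to
  \<open>t + 1\<close>, the new difference is (T_t(u) - T_t(v)) (x) D(u) plus T_t(v) (x) (D(u) -
  D(v)). Normalized ranks multiply and are at most 1, so each factor adds at most its weight times
  the distance.\<close>

lemma rk_ratio_amp_minus_le:
  fixes u :: "'f::field mat"
  assumes u: "u \<in> carrier_mat n n" and v: "v \<in> carrier_mat n n"
  shows "rk_ratio (amp_dim n t) (amp n t u - amp n t v) \<le> rk_ratio n (u - v)"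
proof -
  \<comment> \<open>The factor 1 - 2^-t leaves room for the induction: it grows by 2^-(t+1) per
    step, and the new factor costs only 2^-(t+2).\<close>
  have "rk_ratio (amp_dim n t) (amp n t u - amp n t v) \<le> (1 - 1 / 2 ^ t) * rk_ratio n (u - v)"
  proof (induction t)
    case 0
    show ?case using rk_ratio_minus_self[of "1\<^sub>m 1 :: 'f mat" 1] by simp
  next
    case (Suc t)
    let ?N = "pad_dim n t"
    let ?D = "diag_sum ?N n (1\<^sub>m ?N)"
    let ?d = "amp_dim n t"
    have c: "amp n t u \<in> carrier_mat ?d ?d" "amp n t v \<in> carrier_mat ?d ?d"
      "?D u \<in> carrier_mat (?N + n) (?N + n)" "?D v \<in> carrier_mat (?N + n) (?N + n)"
      using u v by simp_all
    have "rk_ratio (amp_dim n (Suc t)) (amp n (Suc t) u - amp n (Suc t) v)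
      \<le> rk_ratio (?d * (?N + n)) (kron (amp n t u) (?D u) - kron (amp n t v) (?D u))
       + rk_ratio (?d * (?N + n)) (kron (amp n t v) (?D u) - kron (amp n t v) (?D v))"
      unfolding amp.simps amp_dim.simps by (rule rk_ratio_triangle) (use c in auto)
    also have "\<dots> = rk_ratio ?d (amp n t u - amp n t v) * rk_ratio (?N + n) (?D u)
      + rk_ratio ?d (amp n t v) * (rk_ratio n (u - v) / 2 ^ (t + 2))"
    proof -
      have "rk_ratio (?d * (?N + n)) (kron (amp n t u) (?D u) - kron (amp n t v) (?D u))
        = rk_ratio ?d (amp n t u - amp n t v) * rk_ratio (?N + n) (?D u)"
        unfolding kron_minus_left[OF c(1,2,3), symmetric] 
        by (rule rk_ratio_kron[OF minus_carrier_mat[OF c(2)] c(3)])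
      moreover have "rk_ratio (?d * (?N + n)) (kron (amp n t v) (?D u) - kron (amp n t v) (?D v))
        = rk_ratio ?d (amp n t v) * rk_ratio (?N + n) (?D u - ?D v)"
        unfolding kron_minus_right[OF c(2,3,4), symmetric]
        by (rule rk_ratio_kron[OF c(2) minus_carrier_mat[OF c(4)]])
      ultimately show ?thesis
        using rk_ratio_diag_sum_pad[where s = t, OF minus_carrier_mat[OF v, of u]] diag_sum_pad_minus[OF u v, of ?N] 
        by simp
    qed
    also have "\<dots> \<le> ((1 - 1 / 2 ^ t) * rk_ratio n (u - v)) * 1 + 1 * (rk_ratio n (u - v) / 2 ^ (t + 2))"
      using Suc.IH c u v 
      by (intro add_mono mult_mono) (auto simp: rk_ratio_nonneg intro: rk_ratio_le_1)
    also have "\<dots> \<le> (1 - 1 / 2 ^ Suc t) * rk_ratio n (u - v)"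
      using rk_ratio_nonneg[of n "u - v"] by (simp add: field_simps)
    finally show ?case .
  qed
  also have "\<dots> \<le> 1 * rk_ratio n (u - v)"
    by (intro mult_right_mono) (auto simp: rk_ratio_nonneg)
  finally show ?thesis by simp
qed

text \<open>The compressed form of \<open>amp n t u\<close>: each of the first \<open>r\<close>
  factors records the difference of \<open>u\<close> from one \<open>v s\<close>, the others keep
  just the padding. For \<open>r \<le> t\<close> it vanishes at every \<open>v s\<close> with
  \<open>s < r\<close>.\<close>

primrec diff_kron :: "(nat \<Rightarrow> 'f::field mat) \<Rightarrow> nat \<Rightarrow> nat \<Rightarrow> nat \<Rightarrow> 'f mat \<Rightarrow> 'f mat" where
  "diff_kron v r n 0 u = 1\<^sub>m 1"
| "diff_kron v r n (Suc s) u = kron (diff_kron v r n s u)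
     (if s < r then diag_sum (pad_dim n s) n (0\<^sub>m (pad_dim n s) (pad_dim n s)) (u - v s)
      else diag_sum (pad_dim n s) n (1\<^sub>m (pad_dim n s)) (0\<^sub>m n n))"

lemma diff_kron_carrier [simp]:
  assumes "u \<in> carrier_mat n n" "\<And>s. s < r \<Longrightarrow> v s \<in> carrier_mat n n"
  shows "diff_kron v r n t u \<in> carrier_mat (amp_dim n t) (amp_dim n t)"
  using assms by (induction t) (auto simp: minus_carrier_mat)

text \<open>Factor \<open>s\<close> is the zero matrix, and it occurs because
  \<open>s < t\<close>.\<close>

lemma diff_kron_eq_zero:
  assumes "\<And>s. s < r \<Longrightarrow> v s \<in> carrier_mat n n" "s < r" "s < t"
  shows "diff_kron v r n t (v s) = 0\<^sub>m (amp_dim n t) (amp_dim n t)"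
  using \<open>s < t\<close>
proof (induction t)
  case (Suc t)
  let ?N = "pad_dim n t"
  have c: "diff_kron v r n t (v s) \<in> carrier_mat (amp_dim n t) (amp_dim n t)"
    using assms by simp
  show ?case
  proof (cases "s = t")
    case True
    have "v t \<in> carrier_mat n n" using assms True by simp
    then have "v t - v t = 0\<^sub>m n n" by (intro eq_matI) auto
    then have "diag_sum ?N n (0\<^sub>m ?N ?N) (v t - v t) = 0\<^sub>m (?N + n) (?N + n)"
      by (simp add: diag_sum_def)
    then show ?thesis using True c assms(2) by simp
  next
    case False
    with Suc have "diff_kron v r n t (v s) = 0\<^sub>m (amp_dim n t) (amp_dim n t)" by simp
    moreover have "v s \<in> carrier_mat n n" using assms by simp
    ultimately show ?thesis using assms by (auto simp: minus_carrier_mat)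
  qed
qed simp

text \<open>\<open>P\<close> and \<open>Q\<close> are chosen before \<open>u\<close>: the same pair
  has to act on all summands of a linear combination at once.\<close>

lemma diag_sum_compress:
  fixes v :: "'f::field mat"
  assumes v: "v \<in> carrier_mat n n" and le: "n \<le> N"
  shows "\<exists>P\<in>carrier_mat (N + n) (N + n). \<exists>Q\<in>carrier_mat (N + n) (N + n).
    \<forall>u\<in>carrier_mat n n. P * diag_sum N n (1\<^sub>m N) u * Q = diag_sum N n (0\<^sub>m N N) (u - v)"
proof -
  \<comment> \<open>A slice of the padding: \<open>J * J\<^sup>T\<close> is the identity of size
    \<open>n\<close> because \<open>n \<le> N\<close>.\<close>
  define J where "J = mat n N (\<lambda>(i, j). if i = j then 1 else (0 :: 'f))"
  have J: "J \<in> carrier_mat n N" by (simp add: J_def)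
  have JJ: "J * J\<^sup>T = 1\<^sub>m n"
    using le by (intro eq_matI) (auto simp: J_def scalar_prod_def if_distrib[where f="\<lambda>x. x * _"] 
        sum.delta cong: if_cong)
  define L where "L = - v * J"
  have L: "L \<in> carrier_mat n N" using v J by (simp add: L_def)
  have LJ: "L * J\<^sup>T = - v"
    using v J JJ assoc_mult_mat[of "- v" n n J N "J\<^sup>T" n] by (simp add: L_def)
  (* Q puts the first n columns of the identity block on top of u in the last column block;
     P subtracts v times the latter from the former. *)
  define P where "P = four_block_mat (0\<^sub>m N N) (0\<^sub>m N n) L (1\<^sub>m n)"
  define Q where "Q = four_block_mat (0\<^sub>m N N) (J\<^sup>T) (0\<^sub>m n N) (1\<^sub>m n)"
  show ?thesis
  proof (rule bexI[of _ P], rule bexI[of _ Q], rule ballI)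
    show "P \<in> carrier_mat (N + n) (N + n)" "Q \<in> carrier_mat (N + n) (N + n)"
      by (simp_all add: P_def Q_def)
    fix u :: "'f mat" assume u: "u \<in> carrier_mat n n"
    have "P * diag_sum N n (1\<^sub>m N) u = four_block_mat (0\<^sub>m N N) (0\<^sub>m N n) L u"
      unfolding P_def diag_sum_def using u L
      by (subst mult_four_block_mat[of _ N N _ n _ n _ _ N _ n]) auto
    also have "\<dots> * Q = four_block_mat (0\<^sub>m N N) (0\<^sub>m N n) (0\<^sub>m n N) (L * J\<^sup>T + u)"
      unfolding Q_def using u L J
      by (subst mult_four_block_mat[of _ N N _ n _ n _ _ N _ n]) auto
    also have "L * J\<^sup>T + u = u - v" unfolding LJ using u v by (intro eq_matI) auto
    finally show "P * diag_sum N n (1\<^sub>m N) u * Q = diag_sum N n (0\<^sub>m N N) (u - v)"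
      by (simp add: diag_sum_def)
  qed
qed

text \<open>Again one pair serves all \<open>u\<close>. By the mixed-product rule the compressions
  of the single factors may be tensored; in the factors from \<open>r\<close> on, multiplication by
  1 (+) 0 removes \<open>u\<close>.\<close>

lemma amp_compress:
  fixes v :: "nat \<Rightarrow> 'f::field mat"
  assumes v: "\<And>s. s < r \<Longrightarrow> v s \<in> carrier_mat n n"
  shows "\<exists>P\<in>carrier_mat (amp_dim n t) (amp_dim n t). \<exists>Q\<in>carrier_mat (amp_dim n t) (amp_dim n t).
    \<forall>u\<in>carrier_mat n n. P * amp n t u * Q = diff_kron v r n t u"
proof (induction t)
  case 0
  show ?case by (intro bexI[of _ "1\<^sub>m 1"]) simp_all
next
  case (Suc t)
  let ?N = "pad_dim n t"
  let ?d = "amp_dim n t"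
  let ?E = "\<lambda>u. if t < r then diag_sum ?N n (0\<^sub>m ?N ?N) (u - v t) else diag_sum ?N n (1\<^sub>m ?N) (0\<^sub>m n n)"
  obtain P Q where 1: "P \<in> carrier_mat ?d ?d" "Q \<in> carrier_mat ?d ?d"
    "\<And>u. u \<in> carrier_mat n n \<Longrightarrow> P * amp n t u * Q = diff_kron v r n t u"
    using Suc.IH by blast
  obtain P' Q' where 2: "P' \<in> carrier_mat (?N + n) (?N + n)" "Q' \<in> carrier_mat (?N + n) (?N + n)"
    "\<And>u. u \<in> carrier_mat n n \<Longrightarrow> P' * diag_sum ?N n (1\<^sub>m ?N) u * Q' = ?E u"
  proof (cases "t < r")
    case True
    obtain P' Q' where *: "P' \<in> carrier_mat (?N + n) (?N + n)" "Q' \<in> carrier_mat (?N + n) (?N + n)"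
      "\<And>u. u \<in> carrier_mat n n \<Longrightarrow>
        P' * diag_sum ?N n (1\<^sub>m ?N) u * Q' = diag_sum ?N n (0\<^sub>m ?N ?N) (u - v t)"
      using diag_sum_compress[OF v[OF True] le_pad_dim[of n t]] by blast
    show thesis by (rule that[OF *(1,2)]) (use True *(3) in simp)
  next
    case False
    show thesis
    proof (rule that[of "diag_sum ?N n (1\<^sub>m ?N) (0\<^sub>m n n)" "1\<^sub>m (?N + n)"])
      fix u :: "'f mat" assume "u \<in> carrier_mat n n"
      then show "diag_sum ?N n (1\<^sub>m ?N) (0\<^sub>m n n) * diag_sum ?N n (1\<^sub>m ?N) u * 1\<^sub>m (?N + n) = ?E u"
        using False by (simp add: diag_sum_mult right_mult_one_mat[of _ "?N + n" "?N + n"])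
    qed auto
  qed
  show ?case
  proof (rule bexI[of _ "kron P P'"], rule bexI[of _ "kron Q Q'"], rule ballI)
    fix u :: "'f mat" assume u: "u \<in> carrier_mat n n"
    let ?W = "diag_sum ?N n (1\<^sub>m ?N) u"
    have W: "?W \<in> carrier_mat (?N + n) (?N + n)" and A: "amp n t u \<in> carrier_mat ?d ?d"
      using u by auto
    have "kron P P' * amp n (Suc t) u * kron Q Q' = kron (P * amp n t u * Q) (P' * ?W * Q')"
      unfolding amp.simps kron_mult[OF 1(1) 2(1) A W]
      by (rule kron_mult[OF mult_carrier_mat[OF 1(1) A] mult_carrier_mat[OF 2(1) W] 1(2) 2(2)])
    then show "kron P P' * amp n (Suc t) u * kron Q Q' = diff_kron v r n (Suc t) u"
      by (simp only: 1(3)[OF u] 2(3)[OF u] diff_kron.simps)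
  qed (use 1(1,2) 2(1,2) in auto)
qed

text \<open>The normalized rank is the product over the factors. The first \<open>r\<close>
  contribute at least e / 2^(s+2) each; the others contribute 1 - 2^-(s+2) each, and their product
  stays above 1/2 however large \<open>t\<close> is. So the bound is uniform in \<open>n\<close> and
  \<open>t\<close>.\<close>

lemma rk_ratio_diff_kron_ge:
  fixes v :: "nat \<Rightarrow> 'f::field mat"
  assumes n: "n > 0" and u: "u \<in> carrier_mat n n" and v: "\<And>s. s < r \<Longrightarrow> v s \<in> carrier_mat n n"
    and e: "\<And>s. s < r \<Longrightarrow> e \<le> rk_ratio n (u - v s)" "0 \<le> e" and t: "r \<le> t"
  shows "(\<Prod>s<r. e / 2 ^ (s + 2)) / 2 \<le> rk_ratio (amp_dim n t) (diff_kron v r n t u)"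
proof -
  let ?x = "\<lambda>s. if s < r then rk_ratio n (u - v s) / 2 ^ (s + 2) else 1 - 1 / 2 ^ (s + 2)"
  have eq: "rk_ratio (amp_dim n t) (diff_kron v r n t u) = (\<Prod>s<t. ?x s)" for t
  proof (induction t)
    case 0
    show ?case using rk_ratio_one[of 1] by simp
  next
    case (Suc t)
    let ?N = "pad_dim n t"
    let ?E = "if t < r then diag_sum ?N n (0\<^sub>m ?N ?N) (u - v t) else diag_sum ?N n (1\<^sub>m ?N) (0\<^sub>m n n)"
    have c: "diff_kron v r n t u \<in> carrier_mat (amp_dim n t) (amp_dim n t)" 
      "?E \<in> carrier_mat (?N + n) (?N + n)"
      using u v by (auto simp: minus_carrier_mat)
    have "rk_ratio (?N + n) (diag_sum ?N n (1\<^sub>m ?N) (0\<^sub>m n n :: 'f mat)) = 1 - 1 / 2 ^ (t + 2)"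
    proof -
      have N: "real ?N + real n = 2 ^ (t + 2) * real n" 
        using arg_cong[OF pad_dim_add[of n t], of real] by simp
      have "0 < ?N" using le_pad_dim[of n t] n by simp
      then have "rk_ratio (?N + n) (diag_sum ?N n (1\<^sub>m ?N) (0\<^sub>m n n :: 'f mat)) = real ?N / (real ?N + real n)"
        by (simp add: rk_ratio_diag_sum rk_ratio_one)
      also have "\<dots> = (2 ^ (t + 2) * real n - real n) / (2 ^ (t + 2) * real n)"
        using N by (simp add: algebra_simps)
      also have "\<dots> = 1 - 1 / 2 ^ (t + 2)" using n by (simp add: field_simps)
      finally show ?thesis .
    qed
    then have "rk_ratio (?N + n) ?E = ?x t"
      using u v by (simp add: rk_ratio_diag_sum_pad minus_carrier_mat)
    then show ?case using rk_ratio_kron[OF c] Suc by simp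
  qed
  (* The summand 1 / 2 ^ (k + 1) only serves to make the induction go through. *)
  have tail: "1 / 2 + 1 / 2 ^ (k + 1) \<le> (\<Prod>s\<in>{r..<r + k}. 1 - 1 / 2 ^ (s + 2) :: real)" for k
  proof (induction k)
    case (Suc k)
    have "1 / 2 + 1 / 2 ^ (Suc k + 1) \<le> (1 / 2 + 1 / 2 ^ (k + 1)) * (1 - 1 / 2 ^ (k + 2) :: real)"
    proof -
      \<comment> \<open>In terms of y = 2^-k the right side exceeds the left by y (1 - y) /
        8.\<close>
      define y :: real where "y = 1 / 2 ^ k"
      have y: "0 \<le> y" "y \<le> 1" by (auto simp: y_def)
      have p: "1 / 2 ^ (Suc k + 1) = y / 4" "1 / 2 ^ (k + 1) = y / 2" "1 / 2 ^ (k + 2) = y / 4"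
        by (simp_all add: y_def field_simps)
      have "0 \<le> y * (1 - y)" using y by simp
      then show ?thesis unfolding p by (simp add: field_simps)
    qed
    also have "\<dots> \<le> (\<Prod>s\<in>{r..<r + k}. 1 - 1 / 2 ^ (s + 2)) * (1 - 1 / 2 ^ (r + k + 2))"
    proof (intro mult_mono[OF Suc.IH])
      \<comment> \<open>\<open>r = 0\<close> is the worst case: a later starting point only makes
        the new factor larger.\<close>
      have "(2::real) ^ (k + 2) \<le> 2 ^ (r + k + 2)" by (intro power_increasing) auto
      then show "1 - 1 / 2 ^ (k + 2) \<le> 1 - 1 / (2::real) ^ (r + k + 2)" 
        by (intro diff_left_mono divide_left_mono) auto
      have "(1::real) \<le> 2 ^ (k + 2)" by (rule one_le_power) auto
      then show "0 \<le> 1 - 1 / (2::real) ^ (k + 2)" by (simp add: field_simps)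
      show "0 \<le> (\<Prod>s\<in>{r..<r + k}. 1 - 1 / 2 ^ (s + 2) :: real)"
        using Suc.IH by (rule order_trans[rotated]) simp
    qed
    also have "\<dots> = (\<Prod>s\<in>{r..<r + Suc k}. 1 - 1 / 2 ^ (s + 2))" by simp
    finally show ?case .
  qed simp
  \<comment> \<open>The product is cut at \<open>r\<close>: differences before it, padding from
    there on.\<close>
  have "(\<Prod>s<r. e / 2 ^ (s + 2)) * (1 / 2) \<le> (\<Prod>s<r. ?x s) * (\<Prod>s\<in>{r..<t}. ?x s)"
  proof (intro mult_mono)
    show "(\<Prod>s<r. e / 2 ^ (s + 2)) \<le> (\<Prod>s<r. ?x s)"
      using e by (intro prod_mono) (auto intro: divide_right_mono)
    have "1 / 2 \<le> (\<Prod>s\<in>{r..<r + (t - r)}. 1 - 1 / 2 ^ (s + 2) :: real)"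
      using tail[of "t - r"] by (rule order_trans[rotated]) simp
    also have "\<dots> = (\<Prod>s\<in>{r..<t}. ?x s)" using t by (intro prod.cong) auto
    finally show "1 / 2 \<le> (\<Prod>s\<in>{r..<t}. ?x s)" .
    show "0 \<le> (\<Prod>s<r. ?x s)" by (intro prod_nonneg) (auto simp: rk_ratio_nonneg)
  qed auto
  also have "(\<Prod>s<r. ?x s) * (\<Prod>s\<in>{r..<t}. ?x s) = (\<Prod>s<t. ?x s)"
    using t by (subst prod.union_disjoint[symmetric]) (auto intro!: prod.cong)
  finally show ?thesis using eq[of t] by simp
qed

section \<open>Linear combinations of matrices and the key lower bound\<close>

section \<open>Linear combinations\<close>

text \<open>The sum is formed entrywise, since matrices of all sizes share one type and have no
  common zero. The index set \<open>S\<close> is separate from \<open>c\<close>, so that it may be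
  larger than the support of \<open>c\<close>.\<close>

definition mat_lincomb :: "nat \<Rightarrow> ('i \<Rightarrow> 'f::field) \<Rightarrow> 'i set \<Rightarrow> ('i \<Rightarrow> 'f mat) \<Rightarrow> 'f mat" where
  "mat_lincomb d c S X = mat d d (\<lambda>(i, j). \<Sum>g\<in>S. c g * X g $$ (i, j))"

lemma mat_lincomb_carrier [simp]: "mat_lincomb d c S X \<in> carrier_mat d d"
  by (simp add: mat_lincomb_def)

lemma mat_lincomb_cong:
  assumes "\<And>g. g \<in> S \<Longrightarrow> c g = c' g" "\<And>g. g \<in> S \<Longrightarrow> X g = X' g"
  shows "mat_lincomb d c S X = mat_lincomb d c' S X'"
  unfolding mat_lincomb_def using assms by (intro eq_matI) (auto intro!: sum.cong)

text \<open>Allows combinations with different supports to be compared over a common finite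
  set.\<close>

lemma mat_lincomb_support:
  assumes "finite T" "{g. c g \<noteq> 0} \<subseteq> T"
  shows "mat_lincomb d c {g. c g \<noteq> 0} X = mat_lincomb d c T X"
  unfolding mat_lincomb_def using assms by (intro eq_matI) (auto intro!: sum.mono_neutral_left)

lemma mat_lincomb_add:
  "mat_lincomb d (\<lambda>g. c g + c' g) S X = mat_lincomb d c S X + mat_lincomb d c' S X"
  by (intro eq_matI) (auto simp: mat_lincomb_def sum.distrib algebra_simps)

lemma mat_lincomb_minus:
  "mat_lincomb d (\<lambda>g. c g - c' g) S X = mat_lincomb d c S X - mat_lincomb d c' S X"
  by (intro eq_matI) (auto simp: mat_lincomb_def sum_subtractf algebra_simps)

lemma mat_lincomb_smult:
  "mat_lincomb d (\<lambda>g. a * c g) S X = a \<cdot>\<^sub>m mat_lincomb d c S X"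
  by (intro eq_matI) (auto simp: mat_lincomb_def sum_distrib_left algebra_simps)

lemma mat_lincomb_minus_right:
  assumes "\<And>g. g \<in> S \<Longrightarrow> X g \<in> carrier_mat d d" "\<And>g. g \<in> S \<Longrightarrow> Y g \<in> carrier_mat d d"
  shows "mat_lincomb d c S X - mat_lincomb d c S Y = mat_lincomb d c S (\<lambda>g. X g - Y g)"
proof (rule eq_matI)
  fix i j assume "i < dim_row (mat_lincomb d c S (\<lambda>g. X g - Y g))" "j < dim_col (mat_lincomb d c S (\<lambda>g. X g - Y g))"
  then have ij: "i < d" "j < d" by (auto simp: mat_lincomb_def)
  have "(X g - Y g) $$ (i, j) = X g $$ (i, j) - Y g $$ (i, j)" if "g \<in> S" for g
    using assms[OF that] ij by auto
  then show "(mat_lincomb d c S X - mat_lincomb d c S Y) $$ (i, j) = mat_lincomb d c S (\<lambda>g. X g - Y g) $$ (i, j)"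
    using ij by (auto simp: mat_lincomb_def sum_subtractf[symmetric] right_diff_distrib intro!: sum.cong)
qed (auto simp: mat_lincomb_def)

lemma mat_lincomb_mult_right:
  assumes X: "\<And>g. g \<in> S \<Longrightarrow> X g \<in> carrier_mat d d" and A: "A \<in> carrier_mat d d"
  shows "mat_lincomb d c S X * A = mat_lincomb d c S (\<lambda>g. X g * A)"
proof (rule eq_matI)
  fix i j assume "i < dim_row (mat_lincomb d c S (\<lambda>g. X g * A))" "j < dim_col (mat_lincomb d c S (\<lambda>g. X g * A))"
  then have ij: "i < d" "j < d" by (auto simp: mat_lincomb_def)
  have "(mat_lincomb d c S X * A) $$ (i, j) = (\<Sum>k<d. (\<Sum>g\<in>S. c g * X g $$ (i, k)) * A $$ (k, j))"
    using ij A by (simp add: mat_lincomb_def scalar_prod_def lessThan_atLeast0)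
  also have "\<dots> = (\<Sum>g\<in>S. \<Sum>k<d. c g * (X g $$ (i, k) * A $$ (k, j)))"
    unfolding sum_distrib_right mult.assoc by (rule sum.swap)
  also have "\<dots> = (\<Sum>g\<in>S. c g * (X g * A) $$ (i, j))"
  proof (intro sum.cong refl)
    fix g assume "g \<in> S"
    from X[OF this] show "(\<Sum>k<d. c g * (X g $$ (i, k) * A $$ (k, j))) = c g * (X g * A) $$ (i, j)"
      using A ij by (simp add: scalar_prod_def lessThan_atLeast0 sum_distrib_left)
  qed
  finally show "(mat_lincomb d c S X * A) $$ (i, j) = mat_lincomb d c S (\<lambda>g. X g * A) $$ (i, j)"
    using ij by (simp add: mat_lincomb_def)
qed (use A in \<open>auto simp: mat_lincomb_def\<close>)

lemma mat_lincomb_mult_left: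
  assumes X: "\<And>g. g \<in> S \<Longrightarrow> X g \<in> carrier_mat d d" and A: "A \<in> carrier_mat d d"
  shows "A * mat_lincomb d c S X = mat_lincomb d c S (\<lambda>g. A * X g)"
proof (rule eq_matI)
  fix i j assume "i < dim_row (mat_lincomb d c S (\<lambda>g. A * X g))" "j < dim_col (mat_lincomb d c S (\<lambda>g. A * X g))"
  then have ij: "i < d" "j < d" by (auto simp: mat_lincomb_def)
  have "(A * mat_lincomb d c S X) $$ (i, j) = (\<Sum>k<d. A $$ (i, k) * (\<Sum>g\<in>S. c g * X g $$ (k, j)))"
    using ij A by (simp add: mat_lincomb_def scalar_prod_def lessThan_atLeast0)
  also have "\<dots> = (\<Sum>g\<in>S. \<Sum>k<d. c g * (A $$ (i, k) * X g $$ (k, j)))"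
    unfolding sum_distrib_left mult.left_commute[of "A $$ _"] by (rule sum.swap)
  also have "\<dots> = (\<Sum>g\<in>S. c g * (A * X g) $$ (i, j))"
  proof (intro sum.cong refl)
    fix g assume "g \<in> S"
    from X[OF this] show "(\<Sum>k<d. c g * (A $$ (i, k) * X g $$ (k, j))) = c g * (A * X g) $$ (i, j)"
      using A ij by (simp add: scalar_prod_def lessThan_atLeast0 sum_distrib_left)
  qed
  finally show "(A * mat_lincomb d c S X) $$ (i, j) = mat_lincomb d c S (\<lambda>g. A * X g) $$ (i, j)"
    using ij by (simp add: mat_lincomb_def)
qed (use A in \<open>auto simp: mat_lincomb_def\<close>)

lemma mat_lincomb_mult:
  assumes X: "\<And>g. g \<in> S \<Longrightarrow> X g \<in> carrier_mat d d" and Y: "\<And>g. g \<in> T \<Longrightarrow> Y g \<in> carrier_mat d d"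
  shows "mat_lincomb d c S X * mat_lincomb d c' T Y
    = mat_lincomb d (\<lambda>(g, h). c g * c' h) (S \<times> T) (\<lambda>(g, h). X g * Y h)"
proof -
  have "mat_lincomb d c S X * mat_lincomb d c' T Y = mat_lincomb d c S (\<lambda>g. X g * mat_lincomb d c' T Y)"
    by (rule mat_lincomb_mult_right[OF X mat_lincomb_carrier])
  also have "\<dots> = mat_lincomb d c S (\<lambda>g. mat_lincomb d c' T (\<lambda>h. X g * Y h))"
    using X Y by (intro mat_lincomb_cong mat_lincomb_mult_left refl) auto
  also have "\<dots> = mat_lincomb d (\<lambda>(g, h). c g * c' h) (S \<times> T) (\<lambda>(g, h). X g * Y h)"
    by (intro eq_matI) (auto simp: mat_lincomb_def sum_distrib_left sum.cartesian_product mult.assoc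
        intro!: sum.cong)
  finally show ?thesis .
qed

text \<open>The coefficients do not enter the bound, because scalar factors do not increase the
  rank.\<close>

lemma rk_ratio_mat_lincomb_le:
  assumes "finite S" "\<And>g. g \<in> S \<Longrightarrow> X g \<in> carrier_mat d d"
  shows "rk_ratio d (mat_lincomb d c S X) \<le> (\<Sum>g\<in>S. rk_ratio d (X g))"
  using assms
proof (induction S rule: finite_induct)
  case empty
  have "mat_lincomb d c {} X = 0\<^sub>m d d" by (intro eq_matI) (auto simp: mat_lincomb_def)
  then show ?case by simp
next
  case (insert x S)
  have "X x \<in> carrier_mat d d" using insert.prems by simp
  then have "mat_lincomb d c (insert x S) X = c x \<cdot>\<^sub>m X x + mat_lincomb d c S X"
    using insert.hyps by (intro eq_matI) (auto simp: mat_lincomb_def)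
  then show ?case
    using rk_ratio_add_le[of "c x \<cdot>\<^sub>m X x" d "mat_lincomb d c S X"] rk_ratio_smult_le[of "X x" d "c x"] insert
    by force
qed

lemma mat_lincomb_single:
  assumes "finite S" "x \<in> S" "X x \<in> carrier_mat d d" "\<And>g. g \<in> S \<Longrightarrow> g \<noteq> x \<Longrightarrow> X g = 0\<^sub>m d d"
  shows "mat_lincomb d c S X = c x \<cdot>\<^sub>m X x"
proof (rule eq_matI)
  fix i j assume "i < dim_row (c x \<cdot>\<^sub>m X x)" "j < dim_col (c x \<cdot>\<^sub>m X x)"
  then have ij: "i < d" "j < d" using assms(3) by auto
  have "(\<Sum>g\<in>S. c g * X g $$ (i, j)) = (\<Sum>g\<in>{x}. c g * X g $$ (i, j))"
    using assms ij by (intro sum.mono_neutral_right) auto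
  then show "mat_lincomb d c S X $$ (i, j) = (c x \<cdot>\<^sub>m X x) $$ (i, j)"
    using ij assms(3) by (simp add: mat_lincomb_def)
qed (use assms in \<open>auto simp: mat_lincomb_def\<close>)

text \<open>The heart of injectivity: a pair \<open>P\<close>, \<open>Q\<close> that annihilates the
  summands of all \<open>g \<noteq> x\<close> leaves a nonzero multiple of the one at
  \<open>x\<close>, and multiplication cannot raise the rank. The bound involves only
  \<open>e\<close> and the number of summands.\<close>

lemma rk_ratio_amp_lincomb_ge:
  fixes u :: "'i \<Rightarrow> 'f::field mat"
  assumes S: "finite S" "x \<in> S" and c: "c x \<noteq> 0" and u: "\<And>g. g \<in> S \<Longrightarrow> u g \<in> carrier_mat n n"
    and e: "\<And>g. g \<in> S \<Longrightarrow> g \<noteq> x \<Longrightarrow> e \<le> rk_ratio n (u x - u g)" "0 \<le> e"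
    and n: "0 < n" and t: "card S \<le> t"
  shows "(\<Prod>s<card S - 1. e / 2 ^ (s + 2)) / 2 \<le> 
    rk_ratio (amp_dim n t) (mat_lincomb (amp_dim n t) c S (\<lambda>g. amp n t (u g)))"
proof -
  define r where "r = card S - 1"
  let ?d = "amp_dim n t"
  have "card (S - {x}) = r" using S by (simp add: r_def)
  \<comment> \<open>\<open>h\<close> lists the other \<open>card S - 1\<close> indices; their
    matrices become the \<open>v s\<close> to be subtracted.\<close>
  then obtain h where h: "bij_betw h {0..<r} (S - {x})"
    using ex_bij_betw_nat_finite[of "S - {x}"] S(1) by auto
  define v where "v s = u (h s)" for s
  have hS: "h s \<in> S" "h s \<noteq> x" if "s < r" for s
    using bij_betwE[OF h] that by auto
  have v: "v s \<in> carrier_mat n n" if "s < r" for s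
    using hS[OF that] u by (simp add: v_def)
  obtain P Q where PQ: "P \<in> carrier_mat ?d ?d" "Q \<in> carrier_mat ?d ?d"
    "\<And>w. w \<in> carrier_mat n n \<Longrightarrow> P * amp n t w * Q = diff_kron v r n t w"
    using amp_compress[of r v n t, OF v] by blast
  let ?A = "mat_lincomb ?d c S (\<lambda>g. amp n t (u g))"
  have zero: "diff_kron v r n t (u g) = 0\<^sub>m ?d ?d" if g: "g \<in> S" "g \<noteq> x" for g
  proof -
    have "g \<in> h ` {0..<r}" using bij_betw_imp_surj_on[OF h] g by simp
    then obtain s where s: "s < r" "h s = g" by auto
    then have "s < t" using t by (simp add: r_def)
    from diff_kron_eq_zero[of r v n s t, OF v s(1) this] s(2) show ?thesis by (simp add: v_def)
  qed
  have "P * ?A * Q = mat_lincomb ?d c S (\<lambda>g. P * amp n t (u g) * Q)"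
    using u PQ(1,2) by (simp add: mat_lincomb_mult_left mat_lincomb_mult_right)
  also have "\<dots> = mat_lincomb ?d c S (\<lambda>g. diff_kron v r n t (u g))"
    using u PQ(3) by (intro mat_lincomb_cong) auto
  also have "\<dots> = c x \<cdot>\<^sub>m diff_kron v r n t (u x)"
    using S u v zero by (intro mat_lincomb_single) auto
  finally have PAQ: "P * ?A * Q = c x \<cdot>\<^sub>m diff_kron v r n t (u x)" .
  have "(\<Prod>s<r. e / 2 ^ (s + 2)) / 2 \<le> rk_ratio ?d (diff_kron v r n t (u x))"
    using e hS t by (intro rk_ratio_diff_kron_ge n u S v) (auto simp: v_def r_def)
  also have "\<dots> = rk_ratio ?d (P * ?A * Q)"
    unfolding PAQ using c S u v by (simp add: rk_ratio_smult)
  also have "\<dots> \<le> rk_ratio ?d (P * ?A)" using PQ by (intro rk_ratio_mult_le) auto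
  also have "\<dots> \<le> rk_ratio ?d ?A" using PQ by (intro rk_ratio_mult_le) auto
  finally show ?thesis by (simp add: r_def)
qed

lemma square_mult_carrier [simp]:
  "A \<in> carrier_mat n n \<Longrightarrow> B \<in> carrier_mat n n \<Longrightarrow> A * B \<in> carrier_mat n n"
  by simp

section \<open>Classes of sequences of matrices modulo rank distance\<close>

section \<open>Cosets in the ultraproducts\<close>

text \<open>Equality in either ultraproduct, expressed for representatives.\<close>

definition rk_equiv :: "nat filter \<Rightarrow> (nat \<Rightarrow> nat) \<Rightarrow> (nat \<Rightarrow> 'f::field mat) \<Rightarrow> (nat \<Rightarrow> 'f mat) \<Rightarrow> bool" where
  "rk_equiv U d a b \<longleftrightarrow> ((\<lambda>k. rk_ratio (d k) (a k - b k)) \<longlongrightarrow> 0) U"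

lemma rk_ratio_tendsto_0I:
  assumes "\<And>k. rk_ratio (d k) (a k) \<le> f k" "(f \<longlongrightarrow> 0) U"
  shows "((\<lambda>k. rk_ratio (d k) (a k)) \<longlongrightarrow> 0) U"
  by (rule real_tendsto_sandwich[OF _ _ tendsto_const assms(2)])
    (use assms(1) in \<open>auto simp: rk_ratio_nonneg\<close>)

lemma rk_equiv_refl: "(\<And>k. a k \<in> carrier_mat (d k) (d k)) \<Longrightarrow> rk_equiv U d a a"
  by (simp add: rk_equiv_def rk_ratio_minus_self)

lemma rk_equiv_sym:
  assumes "\<And>k. a k \<in> carrier_mat (d k) (d k)" "\<And>k. b k \<in> carrier_mat (d k) (d k)"
  shows "rk_equiv U d a b \<Longrightarrow> rk_equiv U d b a"
  unfolding rk_equiv_def using assms by (subst rk_ratio_minus_commute) auto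

lemma rk_equiv_trans:
  assumes "\<And>k. a k \<in> carrier_mat (d k) (d k)" "\<And>k. b k \<in> carrier_mat (d k) (d k)"
    "\<And>k. c k \<in> carrier_mat (d k) (d k)"
    and "rk_equiv U d a b" "rk_equiv U d b c"
  shows "rk_equiv U d a c"
  unfolding rk_equiv_def
  by (rule rk_ratio_tendsto_0I[OF rk_ratio_triangle[OF assms(1-3)]])
    (use tendsto_add[OF assms(4,5)[unfolded rk_equiv_def]] in simp)

lemma rk_equiv_add:
  assumes "\<And>k. a k \<in> carrier_mat (d k) (d k)" "\<And>k. b k \<in> carrier_mat (d k) (d k)"
    "\<And>k. a' k \<in> carrier_mat (d k) (d k)" "\<And>k. b' k \<in> carrier_mat (d k) (d k)"
    and "rk_equiv U d a a'" "rk_equiv U d b b'"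
  shows "rk_equiv U d (\<lambda>k. a k + b k) (\<lambda>k. a' k + b' k)"
  unfolding rk_equiv_def
proof (rule rk_ratio_tendsto_0I)
  fix k
  have "(a k + b k) - (a' k + b' k) = (a k - a' k) + (b k - b' k)"
    using assms(1-4)[of k] by (intro eq_matI) auto
  then show "rk_ratio (d k) (a k + b k - (a' k + b' k)) 
      \<le> rk_ratio (d k) (a k - a' k) + rk_ratio (d k) (b k - b' k)"
    using rk_ratio_add_le[OF minus_carrier_mat[OF assms(3)] minus_carrier_mat[OF assms(4)]] by simp
qed (use tendsto_add[OF assms(5,6)[unfolded rk_equiv_def]] in simp)

text \<open>Follows from ab - a'b' = (a - a')b + a'(b - b') and the bound of the rank of a product
  by that of each factor.\<close>

lemma rk_equiv_mult:
  assumes a: "\<And>k. a k \<in> carrier_mat (d k) (d k)" and b: "\<And>k. b k \<in> carrier_mat (d k) (d k)"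
    and a': "\<And>k. a' k \<in> carrier_mat (d k) (d k)" and b': "\<And>k. b' k \<in> carrier_mat (d k) (d k)"
    and "rk_equiv U d a a'" "rk_equiv U d b b'"
  shows "rk_equiv U d (\<lambda>k. a k * b k) (\<lambda>k. a' k * b' k)"
  unfolding rk_equiv_def
proof (rule rk_ratio_tendsto_0I)
  fix k
  have "rk_ratio (d k) (a k * b k - a' k * b' k) 
      \<le> rk_ratio (d k) (a k * b k - a' k * b k) + rk_ratio (d k) (a' k * b k - a' k * b' k)"
    using a b a' b' by (intro rk_ratio_triangle) auto
  also have "\<dots> = rk_ratio (d k) ((a k - a' k) * b k) + rk_ratio (d k) (a' k * (b k - b' k))"
    using minus_mult_distrib_mat[OF a a' b, of k] mult_minus_distrib_mat[OF a' b b', of k] by simp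
  also have "\<dots> \<le> rk_ratio (d k) (a k - a' k) + rk_ratio (d k) (b k - b' k)"
    using rk_ratio_mult_le(1)[OF minus_carrier_mat[OF a'[of k], of "a k"] b[of k]]
      rk_ratio_mult_le(2)[OF a'[of k] minus_carrier_mat[OF b'[of k], of "b k"]] by simp
  finally show "rk_ratio (d k) (a k * b k - a' k * b' k)
      \<le> rk_ratio (d k) (a k - a' k) + rk_ratio (d k) (b k - b' k)" .
qed (use tendsto_add[OF assms(5,6)[unfolded rk_equiv_def]] in simp)

lemma rk_equiv_smult:
  assumes "\<And>k. a k \<in> carrier_mat (d k) (d k)" "\<And>k. b k \<in> carrier_mat (d k) (d k)" "rk_equiv U d a b"
  shows "rk_equiv U d (\<lambda>k. c \<cdot>\<^sub>m a k) (\<lambda>k. c \<cdot>\<^sub>m b k)"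
  unfolding rk_equiv_def
proof (rule rk_ratio_tendsto_0I)
  fix k
  have "c \<cdot>\<^sub>m a k - c \<cdot>\<^sub>m b k = c \<cdot>\<^sub>m (a k - b k)"
    using assms(1,2)[of k] by (intro eq_matI) (auto simp: algebra_simps)
  then show "rk_ratio (d k) (c \<cdot>\<^sub>m a k - c \<cdot>\<^sub>m b k) \<le> rk_ratio (d k) (a k - b k)"
    using rk_ratio_smult_le[OF minus_carrier_mat[OF assms(2)]] by simp
qed (use assms(3) in \<open>simp add: rk_equiv_def\<close>)

definition mat_class :: "nat filter \<Rightarrow> (nat \<Rightarrow> nat) \<Rightarrow> (nat \<Rightarrow> 'f::field mat) \<Rightarrow> (nat \<Rightarrow> 'f mat) set" where
  "mat_class U d a = {b. (\<forall>k. b k \<in> carrier_mat (d k) (d k)) \<and> rk_equiv U d b a}"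

lemma mat_class_eqI:
  assumes "\<And>k. a k \<in> carrier_mat (d k) (d k)" "\<And>k. b k \<in> carrier_mat (d k) (d k)" "rk_equiv U d a b"
  shows "mat_class U d a = mat_class U d b"
  using assms rk_equiv_trans[of _ d a b U] rk_equiv_trans[of _ d b a U] rk_equiv_sym[of a d b U]
  unfolding mat_class_def by blast

text \<open>Each \<open>y\<close> is \<open>(y - a) + a\<close>, so the cosets are the classes of
  \<open>rk_equiv\<close>; from here on the ring operations are computed on representatives.\<close>

lemma Mat_ker_coset:
  assumes a: "\<And>k. a k \<in> carrier_mat (d k) (d k)"
  shows "Mat_ker U d +>\<^bsub>Mat_prod d\<^esub> a = mat_class U d a"
proof (intro equalityI subsetI)
  fix y assume "y \<in> Mat_ker U d +>\<^bsub>Mat_prod d\<^esub> a"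
  then obtain h where h: "h \<in> Mat_ker U d" "y = (\<lambda>k. h k + a k)"
    by (auto simp: a_r_coset_def' Mat_prod_def)
  then have hc: "h k \<in> carrier_mat (d k) (d k)" for k by (auto simp: Mat_ker_def Mat_prod_def)
  have "(h k + a k) - a k = h k" for k
    using hc[of k] a[of k] by (intro eq_matI) auto
  then show "y \<in> mat_class U d a"
    using h hc a by (auto simp: mat_class_def rk_equiv_def Mat_ker_def)
next
  fix y assume "y \<in> mat_class U d a"
  then have y: "\<And>k. y k \<in> carrier_mat (d k) (d k)" "rk_equiv U d y a" by (auto simp: mat_class_def)
  then have "(\<lambda>k. y k - a k) \<in> Mat_ker U d"
    using a by (auto simp: Mat_ker_def Mat_prod_def rk_equiv_def minus_carrier_mat)
  moreover have "y = (\<lambda>k. (y k - a k) + a k)"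
  proof
    fix k show "y k = (y k - a k) + a k" using y(1)[of k] a[of k] by (intro eq_matI) auto
  qed
  ultimately show "y \<in> Mat_ker U d +>\<^bsub>Mat_prod d\<^esub> a"
    by (auto simp: a_r_coset_def' Mat_prod_def)
qed

lemma mat_class_self: "(\<And>k. a k \<in> carrier_mat (d k) (d k)) \<Longrightarrow> a \<in> mat_class U d a"
  by (simp add: mat_class_def rk_equiv_refl)

lemma mat_class_carrier:
  assumes "\<And>k. a k \<in> carrier_mat (d k) (d k)"
  shows "mat_class U d a \<in> carrier (Mat_ultra U d)"
  unfolding Mat_ultra_def FactRing_def
  using assms by (auto simp: A_RCOSETS_def' Mat_ker_coset[symmetric] Mat_prod_def)

lemma mat_class_one: "\<one>\<^bsub>Mat_ultra U d\<^esub> = mat_class U d (\<lambda>k. 1\<^sub>m (d k))"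
  unfolding Mat_ultra_def FactRing_def
  using Mat_ker_coset[of "\<lambda>k. 1\<^sub>m (d k)" d U] by (simp add: Mat_prod_def)

text \<open>The quotient product is a union of cosets over all representatives, and by
  \<open>rk_equiv_mult\<close> these cosets coincide.\<close>

lemma mat_class_mult:
  assumes a: "\<And>k. a k \<in> carrier_mat (d k) (d k)" and b: "\<And>k. b k \<in> carrier_mat (d k) (d k)"
  shows "mat_class U d a \<otimes>\<^bsub>Mat_ultra U d\<^esub> mat_class U d b = mat_class U d (\<lambda>k. a k * b k)"
proof -
  have "Mat_ker U d +>\<^bsub>Mat_prod d\<^esub> (x \<otimes>\<^bsub>Mat_prod d\<^esub> y) = mat_class U d (\<lambda>k. a k * b k)"
    if x: "x \<in> mat_class U d a" and y: "y \<in> mat_class U d b" for x y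
  proof -
    have xy: "\<And>k. x k \<in> carrier_mat (d k) (d k)" "\<And>k. y k \<in> carrier_mat (d k) (d k)"
      and e: "rk_equiv U d x a" "rk_equiv U d y b"
      using x y by (auto simp: mat_class_def)
    have "Mat_ker U d +>\<^bsub>Mat_prod d\<^esub> (\<lambda>k. x k * y k) = mat_class U d (\<lambda>k. x k * y k)"
      using xy by (intro Mat_ker_coset) auto
    also have "\<dots> = mat_class U d (\<lambda>k. a k * b k)"
      using xy a b e by (intro mat_class_eqI rk_equiv_mult) auto
    finally show ?thesis by (simp add: Mat_prod_def)
  qed
  \<comment> \<open>The union runs over a nonempty family.\<close>
  moreover have "a \<in> mat_class U d a" "b \<in> mat_class U d b" using mat_class_self a b by blast+
  ultimately show ?thesis
    unfolding Mat_ultra_def FactRing_def rcoset_mult_def by (simp, blast)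
qed

text \<open>The quotient sum is the elementwise sum of two cosets; every \<open>z\<close> in the
  class of the sum is reached as \<open>(z - b) + b\<close>.\<close>

lemma mat_class_add:
  assumes a: "\<And>k. a k \<in> carrier_mat (d k) (d k)" and b: "\<And>k. b k \<in> carrier_mat (d k) (d k)"
  shows "mat_class U d a \<oplus>\<^bsub>Mat_ultra U d\<^esub> mat_class U d b = mat_class U d (\<lambda>k. a k + b k)"
proof -
  have "mat_class U d a <+>\<^bsub>Mat_prod d\<^esub> mat_class U d b = mat_class U d (\<lambda>k. a k + b k)"
  proof (intro equalityI subsetI)
    fix z assume "z \<in> mat_class U d a <+>\<^bsub>Mat_prod d\<^esub> mat_class U d b"
    then obtain x y where "x \<in> mat_class U d a" "y \<in> mat_class U d b" "z = (\<lambda>k. x k + y k)"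
      by (auto simp: set_add_def' Mat_prod_def)
    then show "z \<in> mat_class U d (\<lambda>k. a k + b k)"
      using rk_equiv_add[of x d y a b U] a b by (auto simp: mat_class_def)
  next
    fix z assume z: "z \<in> mat_class U d (\<lambda>k. a k + b k)"
    then have zc: "z k \<in> carrier_mat (d k) (d k)" for k by (simp add: mat_class_def)
    have "(z k - b k) - a k = z k - (a k + b k)" for k
      using zc[of k] a[of k] b[of k] by (intro eq_matI) auto
    then have "(\<lambda>k. z k - b k) \<in> mat_class U d a"
      using z b by (simp add: mat_class_def rk_equiv_def minus_carrier_mat)
    moreover have "z = (\<lambda>k. (z k - b k) + b k)"
    proof
      fix k show "z k = (z k - b k) + b k" using zc[of k] b[of k] by (intro eq_matI) auto
    qed
    ultimately show "z \<in> mat_class U d a <+>\<^bsub>Mat_prod d\<^esub> mat_class U d b"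
      using mat_class_self[of b d U] b by (auto simp: set_add_def' Mat_prod_def)
  qed
  then show ?thesis by (simp add: Mat_ultra_def FactRing_def)
qed

section \<open>Invertible matrices and cosets in the quotient of the general linear groups\<close>

lemma invertible_matE:
  assumes "A \<in> carrier_mat n n" "invertible_mat A"
  obtains B where "B \<in> carrier_mat n n" "A * B = 1\<^sub>m n" "B * A = 1\<^sub>m n"
proof -
  obtain B where B: "A * B = 1\<^sub>m n" "B * A = 1\<^sub>m (dim_row B)"
    using assms by (auto simp: invertible_mat_def inverts_mat_def)
  \<comment> \<open>\<open>invertible_mat\<close> does not state the size of the inverse; it is read
    off from the two products.\<close>
  have "dim_col (A * B) = n" "dim_col (B * A) = dim_row B" using B by simp_all
  then have "B \<in> carrier_mat n n" using assms(1) by auto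
  with B that show thesis by auto
qed

lemma invertible_matI:
  assumes "A \<in> carrier_mat n n" "B \<in> carrier_mat n n" "A * B = 1\<^sub>m n" "B * A = 1\<^sub>m n"
  shows "invertible_mat A"
  using assms by (auto simp: invertible_mat_def inverts_mat_def)

lemma invertible_mat_mult:
  assumes A: "A \<in> carrier_mat n n" "invertible_mat A" and B: "B \<in> carrier_mat n n" "invertible_mat B"
  shows "invertible_mat (A * B)"
proof -
  obtain A' where A': "A' \<in> carrier_mat n n" "A * A' = 1\<^sub>m n" "A' * A = 1\<^sub>m n"
    by (rule invertible_matE[OF A])
  obtain B' where B': "B' \<in> carrier_mat n n" "B * B' = 1\<^sub>m n" "B' * B = 1\<^sub>m n"
    by (rule invertible_matE[OF B])
  have "A * B * (B' * A') = A * (B * B') * A'" "B' * A' * (A * B) = B' * (A' * A) * B"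
    using A(1) B(1) A'(1) B'(1) by (simp_all add: assoc_mult_mat[of _ n n _ n _ n])
  then show ?thesis
    using A(1) B(1) A' B' by (intro invertible_matI[of _ n "B' * A'"]) auto
qed

text \<open>Multiplication by \<open>x\<close> carries sequences close to 1 to sequences close to
  \<open>x\<close>, and multiplication by the inverse of \<open>x\<close> goes back. Hence the group
  quotient is governed by the same relation as the ring quotient.\<close>

lemma GL_null_coset:
  assumes x: "x \<in> carrier (GL_prod n)"
  shows "GL_null U n #>\<^bsub>GL_prod n\<^esub> x = {y \<in> carrier (GL_prod n). rk_equiv U n y x}"
proof (intro equalityI subsetI)
  have xc: "x k \<in> carrier_mat (n k) (n k)" "invertible_mat (x k)" for k
    using x by (auto simp: GL_prod_def)
  {
    fix y assume "y \<in> GL_null U n #>\<^bsub>GL_prod n\<^esub> x"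
    then obtain h where h: "h \<in> GL_null U n" "y = (\<lambda>k. h k * x k)"
      by (auto simp: r_coset_def GL_prod_def)
    have hc: "h k \<in> carrier_mat (n k) (n k)" "invertible_mat (h k)" for k 
      using h by (auto simp: GL_null_def GL_prod_def)
    have "rk_equiv U n h (\<lambda>k. 1\<^sub>m (n k))" using h by (simp add: GL_null_def rk_equiv_def)
    then have "rk_equiv U n (\<lambda>k. h k * x k) (\<lambda>k. 1\<^sub>m (n k) * x k)"
      using hc xc by (intro rk_equiv_mult rk_equiv_refl) auto
    moreover have "1\<^sub>m (n k) * x k = x k" for k using xc(1) by (rule left_mult_one_mat)
    moreover have "invertible_mat (h k * x k)" for k by (rule invertible_mat_mult[OF hc xc])
    ultimately show "y \<in> {y \<in> carrier (GL_prod n). rk_equiv U n y x}"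
      using h xc hc by (auto simp: GL_prod_def)
  next
    fix y assume "y \<in> {y \<in> carrier (GL_prod n). rk_equiv U n y x}"
    then have y: "y k \<in> carrier_mat (n k) (n k)" "invertible_mat (y k)" "rk_equiv U n y x" for k
      by (auto simp: GL_prod_def)
    have "\<exists>b. b \<in> carrier_mat (n k) (n k) \<and> x k * b = 1\<^sub>m (n k) \<and> b * x k = 1\<^sub>m (n k)" for k
      using invertible_matE[OF xc] by metis
    then obtain b where b: "\<And>k. b k \<in> carrier_mat (n k) (n k)" "\<And>k. x k * b k = 1\<^sub>m (n k)"
      "\<And>k. b k * x k = 1\<^sub>m (n k)" by metis
    have "rk_equiv U n (\<lambda>k. y k * b k) (\<lambda>k. x k * b k)"
      using y xc b by (intro rk_equiv_mult rk_equiv_refl) auto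
    moreover have "invertible_mat (y k * b k)" for k
      by (rule invertible_mat_mult[OF y(1,2) b(1) invertible_matI[OF b(1) xc(1) b(3) b(2)]])
    ultimately have "(\<lambda>k. y k * b k) \<in> GL_null U n"
      using y b by (auto simp: GL_null_def GL_prod_def rk_equiv_def)
    moreover have "y = (\<lambda>k. (y k * b k) * x k)"
    proof
      fix k show "y k = (y k * b k) * x k"
        using y(1)[of k] b(1,3)[of k] xc(1)[of k] by (simp add: assoc_mult_mat[of _ "n k" "n k" _ "n k" _ "n k"])
    qed
    ultimately show "y \<in> GL_null U n #>\<^bsub>GL_prod n\<^esub> x"
      by (auto simp: r_coset_def GL_prod_def)
  }
qed

section \<open>Limits along the ultrafilter, convolution in the group algebra, and the
  embedding\<close>

section \<open>The group algebra\<close>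

text \<open>Finitely many indices can be discarded one at a time, so whatever holds from some index
  on holds along \<open>U\<close>.\<close>

lemma le_sequentially_if_nonprincipal:
  assumes "nonprincipal U"
  shows "U \<le> sequentially"
proof (rule filter_leI)
  fix P :: "nat \<Rightarrow> bool" assume "eventually P sequentially"
  then obtain N where N: "\<And>k. k \<ge> N \<Longrightarrow> P k" by (auto simp: eventually_sequentially)
  have "eventually (\<lambda>k. \<forall>i\<in>{..<N}. k \<noteq> i) U"
    using assms by (intro eventually_ball_finite) (auto simp: nonprincipal_def)
  then show "eventually P U"
    by (rule eventually_mono) (use N in \<open>auto simp: not_less[symmetric]\<close>)
qed

text \<open>For an ultrafilter, failing to be eventually below \<open>e\<close> means being
  eventually at least \<open>e\<close>; this turns inequality of two classes into a uniform rank
  distance.\<close>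

lemma ultrafilter_not_tendsto_0:
  assumes U: "ultrafilter_nat U" and f: "\<And>k. 0 \<le> f k" "\<not> (f \<longlongrightarrow> (0::real)) U"
  obtains e where "e > 0" "eventually (\<lambda>k. e \<le> f k) U"
proof -
  obtain e where e: "e > 0" "\<not> eventually (\<lambda>k. dist (f k) 0 < e) U"
    using f(2) by (auto simp: tendsto_iff)
  then have "eventually (\<lambda>k. \<not> dist (f k) 0 < e) U" using U by (auto simp: ultrafilter_nat_def)
  then have "eventually (\<lambda>k. e \<le> f k) U"
    by (rule eventually_mono) (use f(1) in auto)
  with e(1) that show thesis by blast
qed

text \<open>As soon as there is a factor, it alone has dimension at least \<open>n k\<close>, and
  the others have dimension at least 1 once \<open>n k\<close> is positive.\<close>

lemma amp_dim_at_top: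
  assumes "filterlim n at_top sequentially"
  shows "filterlim (\<lambda>k. amp_dim (n k) k) at_top sequentially"
proof (rule filterlim_at_top_mono[OF assms])
  have "eventually (\<lambda>k. 1 \<le> n k) sequentially" using assms by (simp add: filterlim_at_top)
  then show "eventually (\<lambda>k. n k \<le> amp_dim (n k) k) sequentially"
    using eventually_ge_at_top[of 1]
  proof eventually_elim
    case (elim k)
    have "1 \<le> amp_dim (n k) s" for s
      using elim by (induction s) auto
    \<comment> \<open>The last factor has index \<open>k - 1\<close>, which is why
      \<open>k \<ge> 1\<close> is required.\<close>
    then have "1 * n k \<le> amp_dim (n k) (k - 1) * (pad_dim (n k) (k - 1) + n k)"
      by (intro mult_mono) auto
    then show ?case using elim amp_dim.simps(2)[of "n k" "k - 1"] by simp
  qed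
qed

text \<open>The number of factors grows with the index \<open>k\<close>; this is harmless as
  \<open>rk_ratio_amp_minus_le\<close> is uniform in it.\<close>

lemma rk_equiv_amp:
  assumes "\<And>k. a k \<in> carrier_mat (n k) (n k)" "\<And>k. b k \<in> carrier_mat (n k) (n k)"
    and "rk_equiv U n a b"
  shows "rk_equiv U (\<lambda>k. amp_dim (n k) k) (\<lambda>k. amp (n k) k (a k)) (\<lambda>k. amp (n k) k (b k))"
  unfolding rk_equiv_def
  by (rule rk_ratio_tendsto_0I[OF rk_ratio_amp_minus_le[OF assms(1,2)]])
    (use assms(3) in \<open>simp add: rk_equiv_def\<close>)

text \<open>A fixed finite sum of null sequences tends to 0. This carries approximate
  multiplicativity over from group elements to linear combinations.\<close>

lemma rk_equiv_mat_lincomb: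
  assumes S: "finite S" and X: "\<And>g k. g \<in> S \<Longrightarrow> X g k \<in> carrier_mat (d k) (d k)"
    and Y: "\<And>g k. g \<in> S \<Longrightarrow> Y g k \<in> carrier_mat (d k) (d k)"
    and eq: "\<And>g. g \<in> S \<Longrightarrow> rk_equiv U d (X g) (Y g)"
  shows "rk_equiv U d (\<lambda>k. mat_lincomb (d k) c S (\<lambda>g. X g k)) (\<lambda>k. mat_lincomb (d k) c S (\<lambda>g. Y g k))"
  unfolding rk_equiv_def
proof (rule rk_ratio_tendsto_0I)
  fix k
  have "mat_lincomb (d k) c S (\<lambda>g. X g k) - mat_lincomb (d k) c S (\<lambda>g. Y g k) 
    = mat_lincomb (d k) c S (\<lambda>g. X g k - Y g k)"
    using X Y by (intro mat_lincomb_minus_right) auto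
  then show "rk_ratio (d k) (mat_lincomb (d k) c S (\<lambda>g. X g k) - mat_lincomb (d k) c S (\<lambda>g. Y g k))
    \<le> (\<Sum>g\<in>S. rk_ratio (d k) (X g k - Y g k))"
    using rk_ratio_mat_lincomb_le[OF S, of "\<lambda>g. X g k - Y g k" "d k" c] Y by (simp add: minus_carrier_mat)
next
  have "((\<lambda>k. \<Sum>g\<in>S. rk_ratio (d k) (X g k - Y g k)) \<longlongrightarrow> (\<Sum>g\<in>S. 0)) U"
    using eq by (intro tendsto_sum) (auto simp: rk_equiv_def)
  then show "((\<lambda>k. \<Sum>g\<in>S. rk_ratio (d k) (X g k - Y g k)) \<longlongrightarrow> 0) U" by simp
qed

text \<open>The coefficient of an element in a convolution collects all pairs having this element as
  product; expanding it gives the double sum over the two supports.\<close>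

lemma mat_lincomb_group_algebra_mult:
  fixes G :: "'g monoid" (structure) and f h :: "'g \<Rightarrow> 'f::field"
  assumes G: "group G" and f: "f \<in> carrier (group_algebra G)" and h: "h \<in> carrier (group_algebra G)"
  shows "mat_lincomb d (f \<otimes>\<^bsub>group_algebra G\<^esub> h) {x. (f \<otimes>\<^bsub>group_algebra G\<^esub> h) x \<noteq> 0} X
    = mat_lincomb d (\<lambda>(a, b). f a * h b) ({a. f a \<noteq> 0} \<times> {b. h b \<noteq> 0}) (\<lambda>(a, b). X (a \<otimes> b))"
proof -
  interpret group G by fact
  define A where "A = {a. f a \<noteq> 0}"
  define B where "B = {b. h b \<noteq> 0}"
  have A: "finite A" "A \<subseteq> carrier G" and B: "finite B" "B \<subseteq> carrier G"
    using f h by (auto simp: group_algebra_def A_def B_def)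
  \<comment> \<open>The set of all products is finite and contains the support of the
    convolution.\<close>
  define S where "S = (\<lambda>(a, b). a \<otimes> b) ` (A \<times> B)"
  have S: "finite S" "S \<subseteq> carrier G" using A B by (auto simp: S_def)
  define p where "p = f \<otimes>\<^bsub>group_algebra G\<^esub> h"
  have p: "p x = (\<Sum>a\<in>A. f a * h (inv a \<otimes> x))" if "x \<in> carrier G" for x
    using that by (simp add: p_def group_algebra_def A_def)
  have p0: "p x = 0" if "x \<notin> carrier G" for x
    using that by (simp add: p_def group_algebra_def)
  have supp: "{x. p x \<noteq> 0} \<subseteq> S"
  proof
    fix x assume "x \<in> {x. p x \<noteq> 0}"
    then have x: "p x \<noteq> 0" "x \<in> carrier G" using p0 by auto
    then obtain a where a: "a \<in> A" "f a * h (inv a \<otimes> x) \<noteq> 0"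
      using p by (metis (no_types, lifting) sum.neutral)
    then have "inv a \<otimes> x \<in> B" "x = a \<otimes> (inv a \<otimes> x)"
      using A x by (auto simp: B_def m_assoc[symmetric])
    then show "x \<in> S"
      unfolding S_def using a(1) by (intro image_eqI[of _ _ "(a, inv a \<otimes> x)"]) (simp_all only: prod.case mem_Times_iff fst_conv snd_conv)
  qed
  \<comment> \<open>For fixed \<open>a\<close> the substitution is \<open>x = a \<otimes> b\<close>:
    left translation by \<open>a\<close> is injective, and elements of \<open>S\<close> not of this
    form contribute 0.\<close>
  have inner: "(\<Sum>x\<in>S. h (inv a \<otimes> x) * y x) = (\<Sum>b\<in>B. h b * y (a \<otimes> b))" if a: "a \<in> A" for a and y :: "'g \<Rightarrow> 'f"
  proof -
    have aG: "a \<in> carrier G" using a A by auto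
    have "(\<Sum>x\<in>S. h (inv a \<otimes> x) * y x) = (\<Sum>x\<in>(\<lambda>b. a \<otimes> b) ` B. h (inv a \<otimes> x) * y x)"
    proof (rule sum.mono_neutral_right[OF S(1)])
      show "(\<lambda>b. a \<otimes> b) ` B \<subseteq> S" using a by (auto simp: S_def)
      show "\<forall>x\<in>S - (\<lambda>b. a \<otimes> b) ` B. h (inv a \<otimes> x) * y x = 0"
      proof
        fix x assume x: "x \<in> S - (\<lambda>b. a \<otimes> b) ` B"
        then have "x = a \<otimes> (inv a \<otimes> x)" using aG S by (auto simp: m_assoc[symmetric])
        with x have "inv a \<otimes> x \<notin> B" by blast
        then show "h (inv a \<otimes> x) * y x = 0" by (simp add: B_def)
      qed
    qed
    also have "\<dots> = (\<Sum>b\<in>B. h (inv a \<otimes> (a \<otimes> b)) * y (a \<otimes> b))"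
      using inj_on_subset[OF inj_on_cmult[OF aG] B(2)] by (simp add: sum.reindex)
    also have "\<dots> = (\<Sum>b\<in>B. h b * y (a \<otimes> b))"
      using aG B by (intro sum.cong) (auto simp: m_assoc[symmetric])
    finally show ?thesis .
  qed
  have "mat_lincomb d p {x. p x \<noteq> 0} X = mat_lincomb d p S X"
    by (rule mat_lincomb_support[OF S(1) supp])
  also have "\<dots> = mat_lincomb d (\<lambda>(a, b). f a * h b) (A \<times> B) (\<lambda>(a, b). X (a \<otimes> b))"
  proof (rule eq_matI)
    fix i j assume "i < dim_row (mat_lincomb d (\<lambda>(a, b). f a * h b) (A \<times> B) (\<lambda>(a, b). X (a \<otimes> b)))"
      "j < dim_col (mat_lincomb d (\<lambda>(a, b). f a * h b) (A \<times> B) (\<lambda>(a, b). X (a \<otimes> b)))"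
    then have ij: "i < d" "j < d" by (auto simp: mat_lincomb_def)
    have "(\<Sum>x\<in>S. p x * X x $$ (i, j)) = (\<Sum>x\<in>S. \<Sum>a\<in>A. f a * (h (inv a \<otimes> x) * X x $$ (i, j)))"
      using p S by (intro sum.cong) (auto simp: sum_distrib_right mult.assoc)
    also have "\<dots> = (\<Sum>a\<in>A. f a * (\<Sum>x\<in>S. h (inv a \<otimes> x) * X x $$ (i, j)))"
      by (subst sum.swap) (simp add: sum_distrib_left)
    also have "\<dots> = (\<Sum>a\<in>A. f a * (\<Sum>b\<in>B. h b * X (a \<otimes> b) $$ (i, j)))"
      using inner by (intro sum.cong) auto
    also have "\<dots> = (\<Sum>(a, b)\<in>A \<times> B. f a * h b * X (a \<otimes> b) $$ (i, j))"
      by (simp add: sum_distrib_left sum.cartesian_product mult.assoc)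
    finally show "mat_lincomb d p S X $$ (i, j) 
        = mat_lincomb d (\<lambda>(a, b). f a * h b) (A \<times> B) (\<lambda>(a, b). X (a \<otimes> b)) $$ (i, j)"
      using ij by (simp add: mat_lincomb_def case_prod_unfold)
  qed (auto simp: mat_lincomb_def)
  finally show ?thesis by (simp add: p_def A_def B_def)
qed

text \<open>Works with representatives \<open>x g\<close> of the classes, so that the group law
  holds only up to rank distance.\<close>

lemma group_algebra_embedding:
  fixes G :: "'g monoid" (structure) and x :: "'g \<Rightarrow> nat \<Rightarrow> 'f::field mat"
  assumes G: "group G" and U: "ultrafilter_nat U" "nonprincipal U"
    and n: "filterlim n at_top sequentially"
    and x: "\<And>g k. g \<in> carrier G \<Longrightarrow> x g k \<in> carrier_mat (n k) (n k)"
    and mult: "\<And>g h. g \<in> carrier G \<Longrightarrow> h \<in> carrier G \<Longrightarrow> 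
      rk_equiv U n (\<lambda>k. x g k * x h k) (x (g \<otimes> h))"
    and one: "rk_equiv U n (x \<one>) (\<lambda>k. 1\<^sub>m (n k))"
    and inj: "\<And>g h. g \<in> carrier G \<Longrightarrow> h \<in> carrier G \<Longrightarrow> rk_equiv U n (x g) (x h) \<Longrightarrow> g = h"
  shows "\<exists>(m :: nat \<Rightarrow> nat) (\<Psi> :: ('g \<Rightarrow> 'f) \<Rightarrow> (nat \<Rightarrow> 'f mat) set).
           filterlim m at_top sequentially \<and> alg_hom_ultra G U m \<Psi> \<and>
           inj_on \<Psi> (carrier (group_algebra G))"
proof -
  interpret group G by fact
  let ?F = "group_algebra G :: ('g \<Rightarrow> 'f) ring"
  \<comment> \<open>The index \<open>k\<close> is also the number of factors, so that eventually
    there are at least as many factors as elements in any given finite support.\<close>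
  define m where "m k = amp_dim (n k) k" for k
  define \<phi> where "\<phi> g k = amp (n k) k (x g k)" for g k
  \<comment> \<open>The linear extension on representatives. Sums and scalar multiples are preserved
    exactly, products and the unit only up to \<open>rk_equiv\<close>.\<close>
  define \<Phi> where "\<Phi> f k = mat_lincomb (m k) f {g. f g \<noteq> 0} (\<lambda>g. \<phi> g k)" for f k
  define \<Psi> where "\<Psi> f = mat_class U m (\<Phi> f)" for f
  have \<phi>: "\<phi> g k \<in> carrier_mat (m k) (m k)" if "g \<in> carrier G" for g k
    using x[OF that] by (simp add: \<phi>_def m_def)
  have \<Phi>: "\<Phi> f k \<in> carrier_mat (m k) (m k)" for f k
    by (simp add: \<Phi>_def)
  have supp: "finite {g. f g \<noteq> 0}" "{g. f g \<noteq> 0} \<subseteq> carrier G" if "f \<in> carrier ?F" for f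
    using that by (auto simp: group_algebra_def)
  have \<phi>_mult: "rk_equiv U m (\<lambda>k. \<phi> g k * \<phi> h k) (\<phi> (g \<otimes> h))" if "g \<in> carrier G" "h \<in> carrier G" for g h
    unfolding \<phi>_def m_def using rk_equiv_amp[OF _ _ mult[OF that]] x that by (simp add: amp_mult)
  have \<phi>_one: "rk_equiv U m (\<phi> \<one>) (\<lambda>k. 1\<^sub>m (m k))"
    unfolding \<phi>_def m_def using rk_equiv_amp[OF _ _ one] x by (simp add: amp_one)
  have \<Phi>_mult: "rk_equiv U m (\<lambda>k. \<Phi> f k * \<Phi> h k) (\<Phi> (f \<otimes>\<^bsub>?F\<^esub> h))" 
    if f: "f \<in> carrier ?F" and h: "h \<in> carrier ?F" for f h
  proof -
    let ?S = "{g. f g \<noteq> 0} \<times> {g. h g \<noteq> 0}"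
    have "\<Phi> f k * \<Phi> h k = mat_lincomb (m k) (\<lambda>(a, b). f a * h b) ?S (\<lambda>p. \<phi> (fst p) k * \<phi> (snd p) k)" for k
      unfolding \<Phi>_def using mat_lincomb_mult[of "{g. f g \<noteq> 0}" "\<lambda>g. \<phi> g k" "m k" "{g. h g \<noteq> 0}" "\<lambda>g. \<phi> g k" f h]
        supp[OF f] supp[OF h] \<phi> by (auto simp: case_prod_unfold)
    moreover have "\<Phi> (f \<otimes>\<^bsub>?F\<^esub> h) k = mat_lincomb (m k) (\<lambda>(a, b). f a * h b) ?S (\<lambda>p. \<phi> (fst p \<otimes> snd p) k)" for k
      unfolding \<Phi>_def mat_lincomb_group_algebra_mult[OF G f h] by (simp add: case_prod_unfold)
    moreover have "rk_equiv U m (\<lambda>k. mat_lincomb (m k) (\<lambda>(a, b). f a * h b) ?S (\<lambda>p. \<phi> (fst p) k * \<phi> (snd p) k))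
      (\<lambda>k. mat_lincomb (m k) (\<lambda>(a, b). f a * h b) ?S (\<lambda>p. \<phi> (fst p \<otimes> snd p) k))"
      using supp[OF f] supp[OF h] \<phi> \<phi>_mult
      by (intro rk_equiv_mat_lincomb[where X = "\<lambda>p k. \<phi> (fst p) k * \<phi> (snd p) k" 
            and Y = "\<lambda>p k. \<phi> (fst p \<otimes> snd p) k"]) (auto simp: subset_iff)
    ultimately show ?thesis by presburger
  qed
  have \<Phi>_add: "\<Phi> (f \<oplus>\<^bsub>?F\<^esub> h) = (\<lambda>k. \<Phi> f k + \<Phi> h k)" if f: "f \<in> carrier ?F" and h: "h \<in> carrier ?F" for f h
  proof
    fix k
    \<comment> \<open>Both supports are enlarged to a common set, as terms may cancel in the
      sum.\<close>
    let ?T = "{g. f g \<noteq> 0} \<union> {g. h g \<noteq> 0}"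
    have T: "finite ?T" using supp f h by auto
    have "{g. f g + h g \<noteq> 0} \<subseteq> ?T" by auto
    from mat_lincomb_support[OF T this]
    have "mat_lincomb (m k) (\<lambda>g. f g + h g) {g. f g + h g \<noteq> 0} (\<lambda>g. \<phi> g k)
      = mat_lincomb (m k) f ?T (\<lambda>g. \<phi> g k) + mat_lincomb (m k) h ?T (\<lambda>g. \<phi> g k)"
      by (simp add: mat_lincomb_add)
    also have "\<dots> = \<Phi> f k + \<Phi> h k"
      using mat_lincomb_support[OF T, of f] mat_lincomb_support[OF T, of h] by (simp add: \<Phi>_def)
    finally show "\<Phi> (f \<oplus>\<^bsub>?F\<^esub> h) k = \<Phi> f k + \<Phi> h k" by (simp add: \<Phi>_def group_algebra_def)
  qed
  have \<Phi>_smult: "\<Phi> (\<lambda>g. c * f g) = (\<lambda>k. c \<cdot>\<^sub>m \<Phi> f k)" if f: "f \<in> carrier ?F" for c f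
  proof
    fix k
    show "\<Phi> (\<lambda>g. c * f g) k = c \<cdot>\<^sub>m \<Phi> f k"
      unfolding \<Phi>_def mat_lincomb_smult[symmetric]
      using supp[OF f] by (intro mat_lincomb_support) auto
  qed
  have \<Phi>_one: "\<Phi> \<one>\<^bsub>?F\<^esub> = \<phi> \<one>"
  proof
    fix k
    have "\<one>\<^bsub>?F\<^esub> = (\<lambda>g. if g = \<one> then 1 else 0)" by (simp add: group_algebra_def)
    moreover have "1 \<cdot>\<^sub>m \<phi> \<one> k = \<phi> \<one> k" by (intro eq_matI) auto
    ultimately show "\<Phi> \<one>\<^bsub>?F\<^esub> k = \<phi> \<one> k"
      using \<phi>[OF one_closed, of k] mat_lincomb_single[of "{\<one>}" \<one> "\<lambda>g. \<phi> g k" "m k" "\<one>\<^bsub>?F\<^esub>"]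
      by (simp add: \<Phi>_def)
  qed
  have hom: "\<Psi> \<in> Ring.ring_hom ?F (Mat_ultra U m)"
  proof (rule ring_hom_memI)
    fix f h assume f: "f \<in> carrier ?F" and h: "h \<in> carrier ?F"
    show "\<Psi> f \<in> carrier (Mat_ultra U m)" unfolding \<Psi>_def by (rule mat_class_carrier[OF \<Phi>])
    have "mat_class U m (\<Phi> (f \<otimes>\<^bsub>?F\<^esub> h)) = mat_class U m (\<lambda>k. \<Phi> f k * \<Phi> h k)"
      using \<Phi> by (intro mat_class_eqI rk_equiv_sym[OF _ _ \<Phi>_mult[OF f h]]) auto
    then show "\<Psi> (f \<otimes>\<^bsub>?F\<^esub> h) = \<Psi> f \<otimes>\<^bsub>Mat_ultra U m\<^esub> \<Psi> h"
      by (simp add: \<Psi>_def mat_class_mult[OF \<Phi> \<Phi>])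
    show "\<Psi> (f \<oplus>\<^bsub>?F\<^esub> h) = \<Psi> f \<oplus>\<^bsub>Mat_ultra U m\<^esub> \<Psi> h"
      by (simp add: \<Psi>_def \<Phi>_add[OF f h] mat_class_add[OF \<Phi> \<Phi>])
  next
    show "\<Psi> \<one>\<^bsub>?F\<^esub> = \<one>\<^bsub>Mat_ultra U m\<^esub>"
      unfolding \<Psi>_def \<Phi>_one mat_class_one using \<phi>[OF one_closed] by (intro mat_class_eqI \<phi>_one) auto
  qed
  have lin: "(\<lambda>k. c \<cdot>\<^sub>m a k) \<in> \<Psi> (\<lambda>g. c * f g)" if "f \<in> carrier ?F" "a \<in> \<Psi> f" for c f a
    using that rk_equiv_smult[of a m "\<Phi> f" U c] \<Phi> by (simp add: \<Psi>_def \<Phi>_smult mat_class_def)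
  have "inj_on \<Psi> (carrier ?F)"
  proof (rule inj_onI, rule ccontr)
    fix f h assume f: "f \<in> carrier ?F" and h: "h \<in> carrier ?F" and eq: "\<Psi> f = \<Psi> h" and ne: "f \<noteq> h"
    \<comment> \<open>The difference \<open>d\<close> yields the contradiction: by \<open>eq\<close>
      the normalized rank of its image tends to 0, while the lower bound keeps it away from
      0.\<close>
    define d where "d g = f g - h g" for g
    define S where "S = {g. d g \<noteq> 0}"
    let ?T = "{g. f g \<noteq> 0} \<union> {g. h g \<noteq> 0}"
    have T: "finite ?T" "?T \<subseteq> carrier G" and sub: "S \<subseteq> ?T" 
      using supp f h by (auto simp: S_def d_def)
    then have S: "finite S" "S \<subseteq> carrier G" by (auto intro: finite_subset)
    \<comment> \<open>Any element of the support can take the part of the surviving summand.\<close>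
    obtain y where y: "y \<in> S" using ne by (auto simp: S_def d_def fun_eq_iff)
    have d: "d = (\<lambda>g. f g - h g)" by (simp add: fun_eq_iff d_def)
    have "\<Phi> d k = \<Phi> f k - \<Phi> h k" for k
    proof -
      have "\<Phi> d k = mat_lincomb (m k) d ?T (\<lambda>g. \<phi> g k)"
        unfolding \<Phi>_def using sub by (intro mat_lincomb_support T) (simp add: S_def)
      also have "\<dots> = mat_lincomb (m k) f ?T (\<lambda>g. \<phi> g k) - mat_lincomb (m k) h ?T (\<lambda>g. \<phi> g k)"
        unfolding d by (rule mat_lincomb_minus)
      also have "\<dots> = \<Phi> f k - \<Phi> h k"
        using mat_lincomb_support[OF T(1), of f] mat_lincomb_support[OF T(1), of h] by (simp add: \<Phi>_def)
      finally show ?thesis .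
    qed
    moreover have "\<Phi> f \<in> mat_class U m (\<Phi> h)"
      using mat_class_self[of "\<Phi> f" m U] \<Phi> eq by (simp add: \<Psi>_def)
    ultimately have lim: "((\<lambda>k. rk_ratio (m k) (\<Phi> d k)) \<longlongrightarrow> 0) U"
      by (simp add: mat_class_def rk_equiv_def)
    \<comment> \<open>Injectivity separates \<open>y\<close> from each other element of
      \<open>S\<close> by a distance of its own.\<close>
    have "\<exists>e>0. eventually (\<lambda>k. e \<le> rk_ratio (n k) (x y k - x g k)) U" if g: "g \<in> S" "g \<noteq> y" for g
    proof -
      have "\<not> rk_equiv U n (x y) (x g)" using inj[of y g] g y S by auto
      then show ?thesis
        using ultrafilter_not_tendsto_0[OF U(1), of "\<lambda>k. rk_ratio (n k) (x y k - x g k)"]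
        by (auto simp: rk_ratio_nonneg rk_equiv_def)
    qed
    then obtain E where E: "\<And>g. g \<in> S - {y} \<Longrightarrow> E g > 0"
      "\<And>g. g \<in> S - {y} \<Longrightarrow> eventually (\<lambda>k. E g \<le> rk_ratio (n k) (x y k - x g k)) U"
      by (metis DiffE singletonI)
    \<comment> \<open>A common positive lower bound of finitely many distances; the 1 keeps
      \<open>Min\<close> defined when \<open>y\<close> is the only element of
      \<open>S\<close>.\<close>
    define e where "e = Min (insert 1 (E ` (S - {y})))"
    have e: "e > 0" using E(1) S(1) by (auto simp: e_def)
    have eE: "e \<le> E g" if "g \<in> S - {y}" for g using that S(1) by (auto simp: e_def)
    \<comment> \<open>The bound of \<open>rk_ratio_amp_lincomb_ge\<close>. It does not depend on
      \<open>k\<close>, so it can contradict the limit.\<close>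
    define \<delta> where "\<delta> = (\<Prod>s<card S - 1. e / 2 ^ (s + 2)) / 2"
    have \<delta>: "\<delta> > 0" using e by (auto simp: \<delta>_def intro!: prod_pos)
    have "eventually (\<lambda>k. \<forall>g\<in>S - {y}. E g \<le> rk_ratio (n k) (x y k - x g k)) U"
      using S(1) E(2) by (intro eventually_ball_finite) auto
    moreover have "eventually (\<lambda>k. card S \<le> k) U" "eventually (\<lambda>k. 1 \<le> n k) U"
      using filter_leD[OF le_sequentially_if_nonprincipal[OF U(2)]] eventually_ge_at_top[of "card S"] n
      unfolding filterlim_at_top by blast+
    moreover have "eventually (\<lambda>k. rk_ratio (m k) (\<Phi> d k) < \<delta>) U"
      using order_tendstoD(2)[OF lim \<delta>] .
    ultimately have "eventually (\<lambda>k. False) U"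
    proof eventually_elim
      case (elim k)
      have "\<delta> \<le> rk_ratio (amp_dim (n k) k) (mat_lincomb (amp_dim (n k) k) d S (\<lambda>g. amp (n k) k (x g k)))"
        unfolding \<delta>_def
      proof (rule rk_ratio_amp_lincomb_ge[OF S(1) y])
        show "d y \<noteq> 0" using y by (simp add: S_def)
        show "e \<le> rk_ratio (n k) (x y k - x g k)" if "g \<in> S" "g \<noteq> y" for g
          using elim(1) eE[of g] that by force
      qed (use S x e elim in auto)
      with elim(4) show False by (simp add: \<Phi>_def m_def \<phi>_def S_def)
    qed
    then show False using U(1) by (simp add: ultrafilter_nat_def)
  qed
  with hom lin amp_dim_at_top[OF n] show ?thesis
    unfolding alg_hom_ultra_def m_def[abs_def] by blast
qed

text \<open>A representative is chosen for each class \<open>\<Theta> g\<close>. The properties of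
  \<open>\<Theta>\<close> then become statements on rank distances, to which
  \<open>group_algebra_embedding\<close> applies.\<close>

theorem mainTheorem4:
  fixes G :: "'g monoid" and U :: "nat filter" and n :: "nat \<Rightarrow> nat"
    and \<Theta> :: "'g \<Rightarrow> (nat \<Rightarrow> 'f::field mat) set"
  assumes "group G" and "countable (carrier G)"
    and "ultrafilter_nat U" and "nonprincipal U"
    and "filterlim n at_top sequentially"
    and "\<Theta> \<in> hom G (GL_ultra U n)" and "inj_on \<Theta> (carrier G)"
  shows "\<exists>(m :: nat \<Rightarrow> nat) (\<Psi> :: ('g \<Rightarrow> 'f) \<Rightarrow> (nat \<Rightarrow> 'f mat) set).
           filterlim m at_top sequentially \<and> alg_hom_ultra G U m \<Psi> \<and>
           inj_on \<Psi> (carrier (group_algebra G))"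
proof -
  interpret group G by fact
  have "\<exists>x\<in>carrier (GL_prod n). \<Theta> g = GL_null U n #>\<^bsub>GL_prod n\<^esub> x" if "g \<in> carrier G" for g
    using assms(6) that by (auto simp: hom_def Pi_def GL_ultra_def FactGroup_def RCOSETS_def)
  then obtain x where x: "\<And>g. g \<in> carrier G \<Longrightarrow> x g \<in> carrier (GL_prod n)"
    and \<Theta>0: "\<And>g. g \<in> carrier G \<Longrightarrow> \<Theta> g = GL_null U n #>\<^bsub>GL_prod n\<^esub> x g" by metis
  have \<Theta>: "\<Theta> g = {y \<in> carrier (GL_prod n). rk_equiv U n y (x g)}" if "g \<in> carrier G" for g
    using \<Theta>0[OF that] GL_null_coset[OF x[OF that]] by simp
  have xc: "x g k \<in> carrier_mat (n k) (n k)" "invertible_mat (x g k)" if "g \<in> carrier G" for g k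
    using x[OF that] by (auto simp: GL_prod_def)
  have self: "x g \<in> \<Theta> g" if "g \<in> carrier G" for g
    using x[OF that] xc[OF that] \<Theta>[OF that] rk_equiv_refl[of "x g" n U] by simp
  have mult: "rk_equiv U n (\<lambda>k. x g k * x h k) (x (g \<otimes>\<^bsub>G\<^esub> h))" if g: "g \<in> carrier G" and h: "h \<in> carrier G" for g h
  proof -
    have "\<Theta> (g \<otimes>\<^bsub>G\<^esub> h) = \<Theta> g <#>\<^bsub>GL_prod n\<^esub> \<Theta> h"
      using hom_mult[OF assms(6) g h] by (simp add: GL_ultra_def FactGroup_def)
    then have "(\<lambda>k. x g k * x h k) \<in> \<Theta> (g \<otimes>\<^bsub>G\<^esub> h)"
      using self[OF g] self[OF h] by (auto simp: set_mult_def GL_prod_def)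
    then show ?thesis using \<Theta>[of "g \<otimes>\<^bsub>G\<^esub> h"] g h by simp
  qed
  \<comment> \<open>\<open>hom\<close> provides multiplicativity. So the representative of the unit
    is idempotent up to rank distance, and multiplying by its inverse shows that it is close to
    1.\<close>
  have one: "rk_equiv U n (x \<one>\<^bsub>G\<^esub>) (\<lambda>k. 1\<^sub>m (n k))"
  proof -
    have "\<exists>b. b \<in> carrier_mat (n k) (n k) \<and> x \<one>\<^bsub>G\<^esub> k * b = 1\<^sub>m (n k)" for k
      using invertible_matE[OF xc[OF one_closed]] by metis
    then obtain b where b: "\<And>k. b k \<in> carrier_mat (n k) (n k)" "\<And>k. x \<one>\<^bsub>G\<^esub> k * b k = 1\<^sub>m (n k)" by metis
    have "rk_equiv U n (\<lambda>k. x \<one>\<^bsub>G\<^esub> k * x \<one>\<^bsub>G\<^esub> k * b k) (\<lambda>k. x \<one>\<^bsub>G\<^esub> k * b k)"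
      using mult[OF one_closed one_closed] xc b(1) by (intro rk_equiv_mult rk_equiv_refl) auto
    moreover have "x \<one>\<^bsub>G\<^esub> k * x \<one>\<^bsub>G\<^esub> k * b k = x \<one>\<^bsub>G\<^esub> k" for k
      using assoc_mult_mat[OF xc(1) xc(1) b(1), of "\<one>\<^bsub>G\<^esub>" "\<one>\<^bsub>G\<^esub>" k] b(2) xc(1)[OF one_closed, of k] by simp
    ultimately show ?thesis using b(2) by simp
  qed
  have inj: "g = h" if g: "g \<in> carrier G" and h: "h \<in> carrier G" and e: "rk_equiv U n (x g) (x h)" for g h
  proof (rule inj_onD[OF assms(7) _ g h])
    show "\<Theta> g = \<Theta> h"
    proof -
      \<comment> \<open>By transitivity, representatives at distance 0 determine the same
        coset.\<close>
      have "rk_equiv U n y (x g) \<longleftrightarrow> rk_equiv U n y (x h)" if y: "y \<in> carrier (GL_prod n)" for y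
      proof -
        have yc: "y k \<in> carrier_mat (n k) (n k)" for k using y by (simp add: GL_prod_def)
        show ?thesis
          using rk_equiv_trans[OF yc xc(1)[OF g] xc(1)[OF h] _ e]
            rk_equiv_trans[OF yc xc(1)[OF h] xc(1)[OF g] _ rk_equiv_sym[OF xc(1)[OF g] xc(1)[OF h] e]] 
          by blast
      qed
      then show ?thesis using \<Theta>[OF g] \<Theta>[OF h] by auto
    qed
  qed
  show ?thesis
    by (rule group_algebra_embedding[OF assms(1,3,4,5) xc(1) mult one inj])
qed

end
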